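(* Let $M$ be a connected manifold and let $N_0:TM\to TM$ be a Nijenhuis tensor. Then the tensor $N:TM\oplus T^*M\to TM\oplus T^*M$, $N(X+\xi)=N_0X-{}^tN_0\xi$, is a Nijenhuis tensor for the Courant bracket $$(X+\xi)\circ(Y+\eta)=[X,Y]+(\mathcal{L}_X\eta-i_Yd\xi)$$ on sections of $TM\oplus T^*M$ if and only if $N_0^2=\lambda I$ for a certain $\lambda\in\mathbb{R}$.
   Context: Here $X,Y$ are vector fields and $\xi,\eta$ are 1-forms on $M$; ${}^tN_0:T^*M\to T^*M$ is the dual map, $\langle X,{}^tN_0\xi\rangle=\langle N_0X,\xi\rangle$. For a bilinear operation $\circ$ on sections of a vector bundle $A$ and a vector bundle morphism $N:A\to A$ over the identity (a $(1,1)$-tensor), the contracted product is $X\circ_NY=N(X)\circ Y+X\circ N(Y)-N(X\circ Y)$ and the Nijenhuis torsion is $T_N(X,Y)=N(X)\circ N(Y)-N(X\circ_NY)$. $N$ is called a Nijenhuis tensor for $\circ$ if $T_N=0$ on all sections. "$N_0:TM\to TM$ is a Nijenhuis tensor" means this for the Lie bracket of vector fields. *)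

theory Defs
  imports "HOL-Analysis.Analysis" "HOL-Library.Function_Algebras"
begin

section \<open>Smooth manifolds\<close>

text \<open>
  \<open>Ck_on k U f\<close> is meant for open \<open>U\<close> only. On an arbitrary set, \<open>f\<close> is smooth if near every
  point it is the restriction of a smooth function defined on an open set of the ambient space.
\<close>

primrec Ck_on :: "nat \<Rightarrow> 'a::real_normed_vector set \<Rightarrow> ('a \<Rightarrow> 'b::real_normed_vector) \<Rightarrow> bool" where
  "Ck_on 0 U f \<longleftrightarrow> continuous_on U f"
| "Ck_on (Suc k) U f \<longleftrightarrow>
     (\<forall>x\<in>U. f differentiable (at x)) \<and> (\<forall>v. Ck_on k U (\<lambda>x. frechet_derivative f (at x) v))"

definition smooth_on :: "'a::real_normed_vector set \<Rightarrow> ('a \<Rightarrow> 'b::real_normed_vector) \<Rightarrow> bool" where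
  "smooth_on S f \<longleftrightarrow>
     (\<forall>x\<in>S. \<exists>U g. open U \<and> x \<in> U \<and> (\<forall>k. Ck_on k U g) \<and> (\<forall>y\<in>S \<inter> U. f y = g y))"

type_synonym ('m, 'e) chart = "'m set \<times> ('m \<Rightarrow> 'e)"

text \<open>
  The manifold is the whole type \<open>'m\<close> (Hausdorff and second countable by its type classes). Charts
  take values in a linear subspace \<open>E\<close> of a Euclidean space; since a type of class
  \<open>euclidean_space\<close> has positive dimension, \<open>E = {0}\<close> is what accounts for manifolds of dimension 0.
\<close>

definition smooth_atlas ::
  "'e::euclidean_space set \<Rightarrow> ('m::{t2_space,second_countable_topology}, 'e) chart set \<Rightarrow> bool" where
  "smooth_atlas E A \<longleftrightarrow>
     subspace E \<and>
     (\<Union>(U, \<phi>)\<in>A. U) = UNIV \<and>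
     (\<forall>(U, \<phi>)\<in>A. open U \<and> openin (top_of_set E) (\<phi> ` U) \<and>
        homeomorphism U (\<phi> ` U) \<phi> (inv_into U \<phi>)) \<and>
     (\<forall>(U, \<phi>)\<in>A. \<forall>(V, \<psi>)\<in>A. smooth_on (\<phi> ` (U \<inter> V)) (\<psi> \<circ> inv_into U \<phi>))"

definition smooth_functions :: "('m, 'e::euclidean_space) chart set \<Rightarrow> ('m \<Rightarrow> real) set" where
  "smooth_functions A = {f. \<forall>(U, \<phi>)\<in>A. smooth_on (\<phi> ` U) (f \<circ> inv_into U \<phi>)}"


section \<open>Tangent and cotangent vectors, fields and forms\<close>

text \<open>
  Tangent vectors at \<open>p\<close> are the derivations at \<open>p\<close> of the algebra of smooth functions. They are
  set to 0 on non-smooth functions, and covectors are set to 0 off the tangent space, so that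
  equality of tangent vectors, covectors and sections is equality of HOL functions.
\<close>

type_synonym 'm tvec = "('m \<Rightarrow> real) \<Rightarrow> real"
type_synonym 'm covec = "'m tvec \<Rightarrow> real"

definition tangent_space :: "('m, 'e::euclidean_space) chart set \<Rightarrow> 'm \<Rightarrow> 'm tvec set" where
  "tangent_space A p = {v.
     (\<forall>f\<in>smooth_functions A. \<forall>g\<in>smooth_functions A. v (\<lambda>x. f x + g x) = v f + v g) \<and>
     (\<forall>c. \<forall>f\<in>smooth_functions A. v (\<lambda>x. c * f x) = c * v f) \<and>
     (\<forall>f\<in>smooth_functions A. \<forall>g\<in>smooth_functions A.
        v (\<lambda>x. f x * g x) = f p * v g + g p * v f) \<and>
     (\<forall>f. f \<notin> smooth_functions A \<longrightarrow> v f = 0)}"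

definition cotangent_space :: "('m, 'e::euclidean_space) chart set \<Rightarrow> 'm \<Rightarrow> 'm covec set" where
  "cotangent_space A p = {\<alpha>.
     (\<forall>v\<in>tangent_space A p. \<forall>w\<in>tangent_space A p. \<alpha> (v + w) = \<alpha> v + \<alpha> w) \<and>
     (\<forall>c. \<forall>v\<in>tangent_space A p. \<alpha> (\<lambda>f. c * v f) = c * \<alpha> v) \<and>
     (\<forall>v. v \<notin> tangent_space A p \<longrightarrow> \<alpha> v = 0)}"

definition vector_fields :: "('m, 'e::euclidean_space) chart set \<Rightarrow> ('m \<Rightarrow> 'm tvec) set" where
  "vector_fields A = {X.
     (\<forall>p. X p \<in> tangent_space A p) \<and>
     (\<forall>f\<in>smooth_functions A. (\<lambda>p. X p f) \<in> smooth_functions A)}"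

definition one_forms :: "('m, 'e::euclidean_space) chart set \<Rightarrow> ('m \<Rightarrow> 'm covec) set" where
  "one_forms A = {\<xi>.
     (\<forall>p. \<xi> p \<in> cotangent_space A p) \<and>
     (\<forall>X\<in>vector_fields A. (\<lambda>p. \<xi> p (X p)) \<in> smooth_functions A)}"

definition lie_bracket :: "('m \<Rightarrow> 'm tvec) \<Rightarrow> ('m \<Rightarrow> 'm tvec) \<Rightarrow> 'm \<Rightarrow> 'm tvec" where
  "lie_bracket X Y = (\<lambda>p f. X p (\<lambda>q. Y q f) - Y p (\<lambda>q. X q f))"

definition field_through ::
  "('m, 'e::euclidean_space) chart set \<Rightarrow> 'm \<Rightarrow> 'm tvec \<Rightarrow> 'm \<Rightarrow> 'm tvec" where
  "field_through A p v = (SOME X. X \<in> vector_fields A \<and> X p = v)"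

text \<open>
  Cartan's invariant formulas
  \<open>(L\<^sub>X \<eta>)(Z) = X(\<eta>(Z)) - \<eta>([X, Z])\<close> and \<open>d\<xi>(Y, Z) = Y(\<xi>(Z)) - Z(\<xi>(Y)) - \<xi>([Y, Z])\<close>. On a manifold
  the right-hand sides are linear over the smooth functions in \<open>Z\<close>, resp. in \<open>Y\<close> and \<open>Z\<close>, so their
  values at \<open>p\<close> do not depend on the fields chosen to extend the given tangent vectors.
\<close>

definition lie_derivative ::
  "('m, 'e::euclidean_space) chart set \<Rightarrow> ('m \<Rightarrow> 'm tvec) \<Rightarrow> ('m \<Rightarrow> 'm covec) \<Rightarrow> 'm \<Rightarrow> 'm covec" where
  "lie_derivative A X \<eta> = (\<lambda>p w.
     if w \<in> tangent_space A p then
       (let Z = field_through A p w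
        in X p (\<lambda>q. \<eta> q (Z q)) - \<eta> p (lie_bracket X Z p))
     else 0)"

definition exterior_derivative ::
  "('m, 'e::euclidean_space) chart set \<Rightarrow> ('m \<Rightarrow> 'm covec) \<Rightarrow> 'm \<Rightarrow> 'm tvec \<Rightarrow> 'm covec" where
  "exterior_derivative A \<xi> = (\<lambda>p v w.
     if v \<in> tangent_space A p \<and> w \<in> tangent_space A p then
       (let Y = field_through A p v; Z = field_through A p w
        in Y p (\<lambda>q. \<xi> q (Z q)) - Z p (\<lambda>q. \<xi> q (Y q)) - \<xi> p (lie_bracket Y Z p))
     else 0)"

definition interior_product ::
  "('m \<Rightarrow> 'm tvec) \<Rightarrow> ('m \<Rightarrow> 'm tvec \<Rightarrow> 'm covec) \<Rightarrow> 'm \<Rightarrow> 'm covec" where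
  "interior_product Y \<omega> = (\<lambda>p. \<omega> p (Y p))"


section \<open>Nijenhuis tensors\<close>

text \<open>
  A bundle morphism over the identity is a family \<open>N\<close> of maps of the fibres, which acts on sections
  pointwise. The definitions below are for an arbitrary operation \<open>br\<close> on a set \<open>S\<close> of sections.
\<close>

definition apply_section :: "('m \<Rightarrow> 'f \<Rightarrow> 'f) \<Rightarrow> ('m \<Rightarrow> 'f) \<Rightarrow> 'm \<Rightarrow> 'f" where
  "apply_section N s = (\<lambda>p. N p (s p))"

definition contracted ::
  "(('m \<Rightarrow> 'f::ab_group_add) \<Rightarrow> ('m \<Rightarrow> 'f) \<Rightarrow> 'm \<Rightarrow> 'f) \<Rightarrow> ('m \<Rightarrow> 'f \<Rightarrow> 'f) \<Rightarrow>
   ('m \<Rightarrow> 'f) \<Rightarrow> ('m \<Rightarrow> 'f) \<Rightarrow> 'm \<Rightarrow> 'f" where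
  "contracted br N s t =
     br (apply_section N s) t + br s (apply_section N t) - apply_section N (br s t)"

definition nijenhuis_torsion ::
  "(('m \<Rightarrow> 'f::ab_group_add) \<Rightarrow> ('m \<Rightarrow> 'f) \<Rightarrow> 'm \<Rightarrow> 'f) \<Rightarrow> ('m \<Rightarrow> 'f \<Rightarrow> 'f) \<Rightarrow>
   ('m \<Rightarrow> 'f) \<Rightarrow> ('m \<Rightarrow> 'f) \<Rightarrow> 'm \<Rightarrow> 'f" where
  "nijenhuis_torsion br N s t =
     br (apply_section N s) (apply_section N t) - apply_section N (contracted br N s t)"

definition nijenhuis ::
  "('m \<Rightarrow> 'f::ab_group_add) set \<Rightarrow> (('m \<Rightarrow> 'f) \<Rightarrow> ('m \<Rightarrow> 'f) \<Rightarrow> 'm \<Rightarrow> 'f) \<Rightarrow>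
   ('m \<Rightarrow> 'f \<Rightarrow> 'f) \<Rightarrow> bool" where
  "nijenhuis S br N \<longleftrightarrow> (\<forall>s\<in>S. \<forall>t\<in>S. nijenhuis_torsion br N s t = 0)"

definition tangent_morphism ::
  "('m, 'e::euclidean_space) chart set \<Rightarrow> ('m \<Rightarrow> 'm tvec \<Rightarrow> 'm tvec) \<Rightarrow> bool" where
  "tangent_morphism A N \<longleftrightarrow>
     (\<forall>p. \<forall>v\<in>tangent_space A p. N p v \<in> tangent_space A p) \<and>
     (\<forall>p. \<forall>v\<in>tangent_space A p. \<forall>w\<in>tangent_space A p. N p (v + w) = N p v + N p w) \<and>
     (\<forall>p c. \<forall>v\<in>tangent_space A p. N p (\<lambda>f. c * v f) = (\<lambda>f. c * N p v f)) \<and>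
     (\<forall>X\<in>vector_fields A. apply_section N X \<in> vector_fields A)"


section \<open>The Courant bracket\<close>

definition dual_morphism ::
  "('m, 'e::euclidean_space) chart set \<Rightarrow> ('m \<Rightarrow> 'm tvec \<Rightarrow> 'm tvec) \<Rightarrow> 'm \<Rightarrow> 'm covec \<Rightarrow> 'm covec" where
  "dual_morphism A N p \<alpha> = (\<lambda>v. if v \<in> tangent_space A p then \<alpha> (N p v) else 0)"

definition big_sections ::
  "('m, 'e::euclidean_space) chart set \<Rightarrow> ('m \<Rightarrow> 'm tvec \<times> 'm covec) set" where
  "big_sections A = {s. fst \<circ> s \<in> vector_fields A \<and> snd \<circ> s \<in> one_forms A}"

definition big_morphism ::
  "('m, 'e::euclidean_space) chart set \<Rightarrow> ('m \<Rightarrow> 'm tvec \<Rightarrow> 'm tvec) \<Rightarrow>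
   'm \<Rightarrow> 'm tvec \<times> 'm covec \<Rightarrow> 'm tvec \<times> 'm covec" where
  "big_morphism A N p = (\<lambda>(v, \<alpha>). (N p v, - dual_morphism A N p \<alpha>))"

definition courant_bracket ::
  "('m, 'e::euclidean_space) chart set \<Rightarrow>
   ('m \<Rightarrow> 'm tvec \<times> 'm covec) \<Rightarrow> ('m \<Rightarrow> 'm tvec \<times> 'm covec) \<Rightarrow> 'm \<Rightarrow> 'm tvec \<times> 'm covec" where
  "courant_bracket A s t =
     (let X = fst \<circ> s; \<xi> = snd \<circ> s; Y = fst \<circ> t; \<eta> = snd \<circ> t
      in (\<lambda>p. (lie_bracket X Y p,
               lie_derivative A X \<eta> p - interior_product Y (exterior_derivative A \<xi>) p)))"

end

theory Submission
  imports Defs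
begin

text \<open>
  Write \<open>J = N\<^sub>0\<^sup>2\<close> and \<open>N\<close> for the tensor on \<open>TM \<oplus> T\<^sup>*M\<close>. Cartan's formulas turn the torsion of \<open>N\<close> into an
  expression in brackets and derivatives of pairings. The torsion of \<open>N\<^sub>0\<close> disposes of its vector part
  and of the brackets \<open>[N\<^sub>0 X, N\<^sub>0 Z]\<close>, and for sections \<open>X + \<xi>\<close> and \<open>Y + \<eta>\<close> the covector part that is
  left, evaluated at a field \<open>Z\<close>, is (lemma \<open>torsion_snd\<close>)
  \<open>\<eta>(J[X,Z] - [X,JZ]) + (JZ)(\<xi>(Y)) - Z(\<xi>(JY)) + \<xi>([Y,JZ] - J[Y,Z])\<close>.
  This vanishes if \<open>J\<close> is a constant multiple of the identity.

  Conversely, with \<open>\<xi> = 0\<close> and \<open>\<eta> = df\<close> for arbitrary \<open>f\<close>, the vanishing of the torsion says that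
  \<open>[X,JZ] = J[X,Z]\<close> for all fields, that is, \<open>L\<^sub>X J = 0\<close>. Replacing \<open>X\<close> by \<open>gX\<close> in this identity gives
  \<open>(JZ)(g) X = Z(g) JX\<close> (lemma \<open>square_parallel\<close>), so that \<open>J\<close> is a multiple \<open>\<lambda>(p)\<close> of the identity on
  each tangent space. Replacing \<open>Z\<close> by \<open>gZ\<close>, with \<open>g\<close> a positive smooth function near a point and
  \<open>h = \<lambda>g\<close>, gives \<open>X(h) = \<lambda> X(g)\<close>. Hence \<open>\<lambda> = h/g\<close> has zero derivative in a chart (lemma
  \<open>eigenvalue_constant_on_ball\<close>) and is constant on the connected manifold.

  Both directions rest on the tensoriality of the Lie derivative and of the exterior derivative,
  since these are defined by an arbitrary choice of extensions of tangent vectors to vector fields.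
  Tangent vectors being derivations, Hadamard's lemma in a chart expands them in the coordinate
  derivations. Multiplying the coordinate fields and functions by a bump function \<open>\<rho>\<close> makes the
  expansion global (lemma \<open>frame_expansion\<close>): every vector field satisfies
  \<open>\<rho>\<^sup>3 Z = \<Sum>\<^sub>b c\<^sub>b W\<^sub>b\<close> with fixed global fields \<open>W\<^sub>b\<close> and smooth functions \<open>c\<^sub>b\<close> whose values at a point depend
  only on \<open>Z\<close> at that point. Extension of tangent vectors and tensoriality are immediate consequences.
\<close>

section \<open>Calculus of \<open>C\<^sup>k\<close> functions on open sets\<close>

lemma Ck_on_cong:
  assumes "open U" "\<And>x. x \<in> U \<Longrightarrow> f x = g x" "Ck_on k U f"
  shows "Ck_on k U g"
  using assms(2,3)
proof (induction k arbitrary: f g)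
  case 0
  then show ?case by (metis Ck_on.simps(1) continuous_on_cong)
next
  case (Suc k)
  have d: "(g has_derivative frechet_derivative f (at x)) (at x)" if "x \<in> U" for x
    using Suc.prems that assms(1)
    by (metis Ck_on.simps(2) frechet_derivative_works has_derivative_transform_within_open)
  then have eq: "frechet_derivative f (at x) v = frechet_derivative g (at x) v" if "x \<in> U" for x v
    using frechet_derivative_at that by metis
  show ?case
    unfolding Ck_on.simps
  proof (intro conjI ballI allI)
    show "g differentiable (at x)" if "x \<in> U" for x
      using d that differentiable_def by blast
    show "Ck_on k U (\<lambda>x. frechet_derivative g (at x) v)" for v
      by (rule Suc.IH[of "\<lambda>x. frechet_derivative f (at x) v"]) (use eq Suc.prems in auto)
  qed
qed

lemma Ck_on_SucI:
  assumes "open U" "\<And>x. x \<in> U \<Longrightarrow> (f has_derivative f' x) (at x)"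
    "\<And>v. Ck_on k U (\<lambda>x. f' x v)"
  shows "Ck_on (Suc k) U f"
  unfolding Ck_on.simps
proof (intro conjI ballI allI)
  show "f differentiable (at x)" if "x \<in> U" for x
    using assms(2) that differentiable_def by blast
  have "f' x v = frechet_derivative f (at x) v" if "x \<in> U" for x v
    using frechet_derivative_at[OF assms(2)[OF that]] by simp
  then show "Ck_on k U (\<lambda>x. frechet_derivative f (at x) v)" for v
    by (rule Ck_on_cong[OF assms(1) _ assms(3)]) auto
qed

lemma Ck_on_derivative:
  assumes "Ck_on (Suc k) U f" "x \<in> U"
  shows "(f has_derivative frechet_derivative f (at x)) (at x)"
  using assms frechet_derivative_works by auto

lemma Ck_on_Suc_imp: "Ck_on (Suc k) U f \<Longrightarrow> Ck_on k U f"
proof (induction k arbitrary: f)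
  case 0
  then show ?case
    by (auto intro!: continuous_at_imp_continuous_on differentiable_imp_continuous_within)
next
  case (Suc k)
  then show ?case by auto
qed

lemma Ck_on_subset: "Ck_on k U f \<Longrightarrow> V \<subseteq> U \<Longrightarrow> Ck_on k V f"
  by (induction k arbitrary: f) (auto intro: continuous_on_subset)

lemma Ck_on_local:
  assumes "\<And>x. x \<in> U \<Longrightarrow> \<exists>V. open V \<and> x \<in> V \<and> Ck_on k V f"
  shows "Ck_on k U f"
  using assms
proof (induction k arbitrary: f)
  case 0
  have "continuous (at x) f" if "x \<in> U" for x
    using 0[OF that] by (auto simp: continuous_on_eq_continuous_at)
  then show ?case by (auto intro: continuous_at_imp_continuous_on)
next
  case (Suc k)
  show ?case unfolding Ck_on.simps
  proof (intro conjI ballI allI)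
    show "f differentiable (at x)" if "x \<in> U" for x
      using Suc.prems[OF that] by auto
    show "Ck_on k U (\<lambda>x. frechet_derivative f (at x) v)" for v
      by (rule Suc.IH) (use Suc.prems in fastforce)
  qed
qed

lemma Ck_on_const: "open U \<Longrightarrow> Ck_on k U (\<lambda>x. c)"
proof (induction k arbitrary: c)
  case (Suc k)
  then show ?case by (intro Ck_on_SucI[where f' = "\<lambda>x v. 0"]) auto
qed auto

lemma Ck_on_linear:
  assumes "open U" "bounded_linear f"
  shows "Ck_on k U f"
proof (cases k)
  case 0
  then show ?thesis using assms by (simp add: linear_continuous_on)
next
  case (Suc j)
  show ?thesis
    unfolding Suc
    by (intro Ck_on_SucI[where f' = "\<lambda>x. f"] Ck_on_const bounded_linear_imp_has_derivative assms)
qed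

lemma Ck_on_add:
  assumes "open U" "Ck_on k U f" "Ck_on k U g"
  shows "Ck_on k U (\<lambda>x. f x + g x)"
  using assms(2,3)
proof (induction k arbitrary: f g)
  case 0
  then show ?case by (simp add: continuous_on_add)
next
  case (Suc k)
  have "Ck_on k U (\<lambda>x. frechet_derivative f (at x) v + frechet_derivative g (at x) v)" for v
    using Suc by auto
  then show ?case
    using Ck_on_derivative[OF Suc.prems(1)] Ck_on_derivative[OF Suc.prems(2)] assms(1)
    by (intro Ck_on_SucI[where f' = "\<lambda>x v. frechet_derivative f (at x) v + frechet_derivative g (at x) v"])
      (auto intro: has_derivative_add)
qed

lemma Ck_on_sum:
  assumes "open U" "\<And>i. i \<in> I \<Longrightarrow> Ck_on k U (f i)"
  shows "Ck_on k U (\<lambda>x. \<Sum>i\<in>I. f i x)"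
  using assms(2)
  by (induction I rule: infinite_finite_induct) (auto intro: Ck_on_add Ck_on_const assms(1))

lemma Ck_on_bilinear:
  assumes "open U" "bounded_bilinear m" "Ck_on k U f" "Ck_on k U g"
  shows "Ck_on k U (\<lambda>x. m (f x) (g x))"
  using assms(3,4)
proof (induction k arbitrary: f g)
  case 0
  then show ?case using assms(2) by (auto intro: bounded_bilinear.continuous_on)
next
  case (Suc k)
  let ?D = "\<lambda>x v. m (f x) (frechet_derivative g (at x) v) + m (frechet_derivative f (at x) v) (g x)"
  have "Ck_on k U (\<lambda>x. ?D x v)" for v
    using Suc.prems by (intro Ck_on_add Suc.IH assms(1)) (use Ck_on_Suc_imp in auto)
  moreover have "((\<lambda>x. m (f x) (g x)) has_derivative ?D x) (at x)" if "x \<in> U" for x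
    using bounded_bilinear.FDERIV[OF assms(2)] Ck_on_derivative[OF Suc.prems(1) that]
      Ck_on_derivative[OF Suc.prems(2) that] by blast
  ultimately show ?case
    by (intro Ck_on_SucI[where f' = ?D] assms(1))
qed

lemmas Ck_on_mult = Ck_on_bilinear[OF _ bounded_bilinear_mult]
lemmas Ck_on_scaleR = Ck_on_bilinear[OF _ bounded_bilinear_scaleR]
lemmas Ck_on_inner = Ck_on_bilinear[OF _ bounded_bilinear_inner]

text \<open>
  The chain rule writes a directional derivative of the composition as a sum over \<open>Basis\<close> of products of
  directional derivatives of the two functions, to which the induction hypothesis applies. This is why
  the values of the inner function lie in a Euclidean space.
\<close>

lemma Ck_on_compose:
  fixes g :: "'a::real_normed_vector \<Rightarrow> 'b::euclidean_space"
  assumes "open U" "open V" "Ck_on k V f" "Ck_on k U g" "g ` U \<subseteq> V"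
  shows "Ck_on k U (\<lambda>x. f (g x))"
  using assms(3,4)
proof (induction k arbitrary: f)
  case 0
  then show ?case using assms(5) by (auto intro: continuous_on_compose2)
next
  case (Suc k)
  let ?D = "\<lambda>x v. \<Sum>b\<in>Basis. (frechet_derivative g (at x) v \<bullet> b) *\<^sub>R frechet_derivative f (at (g x)) b"
  have "Ck_on k U (\<lambda>x. ?D x v)" for v
  proof (intro Ck_on_sum Ck_on_scaleR Ck_on_inner Ck_on_const assms(1))
    show "Ck_on k U (\<lambda>x. frechet_derivative g (at x) v)" using Suc.prems by auto
    show "Ck_on k U (\<lambda>x. frechet_derivative f (at (g x)) b)" for b
      using Suc.prems Ck_on_Suc_imp by (intro Suc.IH[of "\<lambda>y. frechet_derivative f (at y) b"]) auto
  qed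
  moreover have "((\<lambda>x. f (g x)) has_derivative ?D x) (at x)" if "x \<in> U" for x
  proof -
    have df: "(f has_derivative frechet_derivative f (at (g x))) (at (g x))"
      using Ck_on_derivative[OF Suc.prems(1)] assms(5) that by blast
    interpret bounded_linear "frechet_derivative f (at (g x))"
      using df has_derivative_bounded_linear by blast
    have "?D x v = frechet_derivative f (at (g x)) (frechet_derivative g (at x) v)" for v
    proof -
      have "?D x v = frechet_derivative f (at (g x)) (\<Sum>b\<in>Basis. (frechet_derivative g (at x) v \<bullet> b) *\<^sub>R b)"
        by (simp add: sum scaleR)
      then show ?thesis by (simp only: euclidean_representation)
    qed
    then show ?thesis
      using has_derivative_compose[OF Ck_on_derivative[OF Suc.prems(2) that] df] by presburger
  qed
  ultimately show ?case
    by (intro Ck_on_SucI[where f' = ?D] assms(1))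
qed

lemma Ck_on_all_derivative:
  assumes "\<And>k. Ck_on k U f"
  shows "Ck_on k U (\<lambda>x. frechet_derivative f (at x) v)"
  using assms[of "Suc k"] by simp

section \<open>Smooth bump functions\<close>

text \<open>
  The factor \<open>x ^ n\<close> makes the family closed under differentiation up to linear combinations, so that
  smoothness of all its members is a single induction.
\<close>

definition flat :: "nat \<Rightarrow> real \<Rightarrow> real" where
  "flat n x = (if x > 0 then exp (- 1 / x) / x ^ n else 0)"

lemma flat_tendsto_0: "((\<lambda>x. flat n x) \<longlongrightarrow> 0) (at 0)"
proof -
  have "((\<lambda>x. exp (- 1 / x) / x ^ n) \<longlongrightarrow> 0) (at_right (0::real))"
  proof -
    have "((\<lambda>y::real. y ^ n / exp y) \<longlongrightarrow> 0) at_top"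
      by (rule tendsto_power_div_exp_0)
    then have "((\<lambda>x::real. (inverse x) ^ n / exp (inverse x)) \<longlongrightarrow> 0) (at_right 0)"
      by (rule filterlim_compose) (rule filterlim_inverse_at_top_right)
    then show ?thesis
      by (simp add: exp_minus field_simps)
  qed
  moreover have "eventually (\<lambda>x. exp (- 1 / x) / x ^ n = flat n x) (at_right (0::real))"
    by (auto simp: eventually_at_filter flat_def)
  ultimately have r: "((\<lambda>x. flat n x) \<longlongrightarrow> 0) (at_right 0)"
    using Lim_transform_eventually by blast
  have "eventually (\<lambda>x. 0 = flat n x) (at_left (0::real))"
    by (auto simp: eventually_at_filter flat_def)
  then have "((\<lambda>x. flat n x) \<longlongrightarrow> 0) (at_left 0)"
    using Lim_transform_eventually tendsto_const by blast
  with r show ?thesis by (simp add: filterlim_at_split)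
qed

lemma flat_has_derivative:
  "(flat n has_real_derivative (flat (n + 2) x - real n * flat (Suc n) x)) (at x)"
proof (cases x "0::real" rule: linorder_cases)
  case less
  have "((\<lambda>x. 0) has_real_derivative 0) (at x)" by simp
  then have "(flat n has_real_derivative 0) (at x)"
    by (rule has_field_derivative_transform_within_open[of _ _ _ "{..<0}"])
      (use less in \<open>auto simp: flat_def\<close>)
  then show ?thesis using less by (simp add: flat_def)
next
  case equal
  have "((\<lambda>y. (flat n y - flat n 0) / (y - 0)) \<longlongrightarrow> 0) (at 0)"
  proof (rule Lim_transform_eventually[OF flat_tendsto_0[of "Suc n"]])
    show "eventually (\<lambda>y. flat (Suc n) y = (flat n y - flat n 0) / (y - 0)) (at 0)"
      by (auto simp: eventually_at_filter flat_def)
  qed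
  then show ?thesis using equal by (simp add: flat_def has_field_derivative_iff)
next
  case greater
  have "((\<lambda>x. exp (- 1 / x) / x ^ n) has_real_derivative (flat (n + 2) x - real n * flat (Suc n) x)) (at x)"
    using greater
    apply (auto intro!: derivative_eq_intros simp: flat_def)
    apply (cases n)
     apply (auto simp: field_simps power2_eq_square)
    done
  then show ?thesis
    by (rule has_field_derivative_transform_within_open[of _ _ _ "{0<..}"])
      (use greater in \<open>auto simp: flat_def\<close>)
qed

lemma Ck_on_flat: "Ck_on k UNIV (flat n)"
proof (induction k arbitrary: n)
  case 0
  have "isCont (flat n) x" for x using flat_has_derivative DERIV_isCont by blast
  then show ?case by (simp add: continuous_at_imp_continuous_on)
next
  case (Suc k)
  show ?case
  proof (rule Ck_on_SucI[where f' = "\<lambda>x v. (flat (n + 2) x - real n * flat (Suc n) x) * v"])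
    show "(flat n has_derivative (\<lambda>v. (flat (n + 2) x - real n * flat (Suc n) x) * v)) (at x)" for x
      using flat_has_derivative[of n x] by (simp add: has_field_derivative_def)
    have "Ck_on k UNIV (\<lambda>x. (flat (n + 2) x + (- real n) * flat (Suc n) x) * v)" for v
      by (intro Ck_on_mult Ck_on_add Ck_on_const Suc.IH) auto
    then show "Ck_on k UNIV (\<lambda>x. (flat (n + 2) x - real n * flat (Suc n) x) * v)" for v
      by simp
  qed auto
qed

text \<open>
  Positive exactly on the open ball of radius \<open>r\<close>, but without a plateau: below, identities are localized
  by multiplying both sides by a power of the bump, which can be divided out at a given point.
\<close>

definition bump :: "'a::euclidean_space \<Rightarrow> real \<Rightarrow> 'a \<Rightarrow> real" where
  "bump a r z = flat 0 (r\<^sup>2 - (z - a) \<bullet> (z - a))"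

lemma Ck_on_bump: "open U \<Longrightarrow> Ck_on k U (bump a r)"
proof -
  assume U: "open U"
  have 1: "Ck_on k U (\<lambda>z. z - a)"
    using Ck_on_add[OF U Ck_on_linear[OF U bounded_linear_ident] Ck_on_const[OF U, of _ "-a"]] by simp
  have "Ck_on k U (\<lambda>z. r\<^sup>2 + (-1) * ((z - a) \<bullet> (z - a)))"
    by (intro Ck_on_add Ck_on_mult Ck_on_inner Ck_on_const 1 U)
  then have "Ck_on k U (\<lambda>z. r\<^sup>2 - (z - a) \<bullet> (z - a))" by simp
  from Ck_on_compose[OF U open_UNIV Ck_on_flat this] show ?thesis
    unfolding bump_def by auto
qed

lemma bump_pos_iff: "r > 0 \<Longrightarrow> bump a r z > 0 \<longleftrightarrow> z \<in> ball a r"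
proof -
  assume r: "r > 0"
  have "(z - a) \<bullet> (z - a) < r\<^sup>2 \<longleftrightarrow> dist a z < r"
    using r norm_lt_square[of "z - a" r] by (simp add: dist_norm norm_minus_commute)
  then show ?thesis by (auto simp: bump_def flat_def)
qed

lemma bump_nonneg: "bump a r z \<ge> 0" by (simp add: bump_def flat_def)

lemma bump_eq_0_iff: "r > 0 \<Longrightarrow> bump a r z = 0 \<longleftrightarrow> z \<notin> ball a r"
  using bump_pos_iff[of r a z] bump_nonneg[of a r z] by (auto simp: order_less_le)

section \<open>Hadamard's lemma\<close>

lemma segment_in_ball:
  fixes a :: "'a::real_normed_vector"
  assumes "z0 \<in> ball a R" "z \<in> ball a R" "t \<in> {0..1::real}"
  shows "z0 + t *\<^sub>R (z - z0) \<in> ball a R"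
proof -
  have "(1 - t) *\<^sub>R z0 + t *\<^sub>R z \<in> ball a R"
    using assms convex_ball[of a R] by (auto simp: convex_alt)
  then show ?thesis by (simp add: algebra_simps)
qed

lemma segment_map_in_ball:
  fixes a :: "'a::real_normed_vector"
  assumes "z0 \<in> ball a R"
  shows "(\<lambda>p. z0 + snd p *\<^sub>R (fst p - z0)) ` (ball a R \<times> cbox 0 (1::real)) \<subseteq> ball a R"
    and "z \<in> ball a R \<Longrightarrow> (\<lambda>t. z0 + t *\<^sub>R (z - z0)) ` cbox 0 (1::real) \<subseteq> ball a R"
proof -
  show "(\<lambda>p. z0 + snd p *\<^sub>R (fst p - z0)) ` (ball a R \<times> cbox 0 (1::real)) \<subseteq> ball a R"
    using segment_in_ball[OF assms] by (auto simp only: box_real mem_Sigma_iff fst_conv snd_conv)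
next
  assume "z \<in> ball a R"
  then show "(\<lambda>t. z0 + t *\<^sub>R (z - z0)) ` cbox 0 (1::real) \<subseteq> ball a R"
    using segment_in_ball[OF assms] unfolding box_real by blast
qed

text \<open>
  Differentiation under the integral sign produces another factor \<open>t\<close>. With the weight \<open>t ^ n\<close> the class
  of integrals is closed under directional derivatives, and the induction on \<open>k\<close> goes through.
\<close>

lemma Ck_on_segment_integral:
  fixes f :: "'a::euclidean_space \<Rightarrow> real"
  assumes z0: "z0 \<in> ball a R" and f: "\<And>k. Ck_on k (ball a R) f"
  shows "Ck_on k (ball a R) (\<lambda>z. integral {0..1} (\<lambda>t. t ^ n * f (z0 + t *\<^sub>R (z - z0))))"
  using f
proof (induction k arbitrary: n f)
  case 0
  have "continuous_on (ball a R) f" using 0[of 0] by simp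
  moreover have "continuous_on (ball a R \<times> cbox 0 1) (\<lambda>p. z0 + snd p *\<^sub>R (fst p - z0))"
    by (intro continuous_intros)
  ultimately have "continuous_on (ball a R \<times> cbox 0 1) (\<lambda>p. f (z0 + snd p *\<^sub>R (fst p - z0)))"
    using segment_map_in_ball(1)[OF z0] by (rule continuous_on_compose2)
  then have "continuous_on (ball a R \<times> cbox 0 1) (\<lambda>(z, t). t ^ n * f (z0 + t *\<^sub>R (z - z0)))"
    unfolding split_beta by (intro continuous_intros)
  from integral_continuous_on_param[OF this] show ?case by simp
next
  case (Suc k)
  let ?s = "\<lambda>z t. z0 + t *\<^sub>R (z - z0)"
  let ?B = "\<lambda>y. Blinfun (frechet_derivative f (at y))"
  let ?fx = "\<lambda>z t. t ^ Suc n *\<^sub>R ?B (?s z t)"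
  have df: "(f has_derivative frechet_derivative f (at y)) (at y)" if "y \<in> ball a R" for y
    using Ck_on_derivative[OF Suc.prems(1)] that by blast
  have B: "blinfun_apply (?B y) = frechet_derivative f (at y)" if "y \<in> ball a R" for y
    using df[OF that] has_derivative_bounded_linear bounded_linear_Blinfun_apply by blast
  have "continuous_on (ball a R) ?B"
  proof (rule continuous_on_blinfun_componentwise)
    fix i :: 'a assume "i \<in> Basis"
    have "continuous_on (ball a R) (\<lambda>y. frechet_derivative f (at y) i)"
      using Suc.prems[of 1] by simp
    then show "continuous_on (ball a R) (\<lambda>y. blinfun_apply (?B y) i)"
      using B by (metis (no_types, lifting) continuous_on_cong)
  qed
  moreover have "continuous_on (ball a R \<times> cbox 0 1) (\<lambda>p. z0 + snd p *\<^sub>R (fst p - z0))"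
    by (intro continuous_intros)
  ultimately have "continuous_on (ball a R \<times> cbox 0 1) (\<lambda>p. ?B (z0 + snd p *\<^sub>R (fst p - z0)))"
    using segment_map_in_ball(1)[OF z0] by (rule continuous_on_compose2)
  then have cont: "continuous_on (ball a R \<times> cbox 0 1) (\<lambda>(z, t). ?fx z t)"
    unfolding split_beta by (intro continuous_intros)
  have contf: "continuous_on (ball a R) f" using Suc.prems[of 0] by simp
  let ?F = "\<lambda>z. integral (cbox 0 1) (\<lambda>t. t ^ n * f (?s z t))"
  show ?case
  proof (rule Ck_on_SucI[where f' = "\<lambda>z v. integral {0..1} (\<lambda>t. t ^ Suc n * frechet_derivative f (at (?s z t)) v)"])
    show "Ck_on k (ball a R) (\<lambda>z. integral {0..1} (\<lambda>t. t ^ Suc n * frechet_derivative f (at (?s z t)) v))" for v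
      using Suc.IH[of "\<lambda>y. frechet_derivative f (at y) v" "Suc n"] Ck_on_all_derivative[of "ball a R" f] Suc.prems
      by blast
    fix z assume z: "z \<in> ball a R"
    have fder: "((\<lambda>z. t ^ n * f (?s z t)) has_derivative blinfun_apply (?fx z t)) (at z within ball a R)"
      if "z \<in> ball a R" "t \<in> cbox 0 1" for z t
    proof -
      have m: "?s z t \<in> ball a R" using segment_in_ball[OF z0] that by (simp only: box_real)
      have "((\<lambda>z. ?s z t) has_derivative (\<lambda>v. t *\<^sub>R v)) (at z)"
        by (auto intro!: derivative_eq_intros)
      from has_derivative_compose[OF this df[OF m]]
      have "((\<lambda>z. t ^ n * f (?s z t)) has_derivative
          (\<lambda>v. t ^ n * frechet_derivative f (at (?s z t)) (t *\<^sub>R v))) (at z)"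
        by (rule has_derivative_mult_right)
      moreover have "(\<lambda>v. t ^ n * frechet_derivative f (at (?s z t)) (t *\<^sub>R v)) = blinfun_apply (?fx z t)"
        using linear_scale[OF has_derivative_linear[OF df[OF m]]] B[OF m]
        by (auto simp: blinfun.scaleR_left fun_eq_iff)
      ultimately show ?thesis by (simp add: has_derivative_at_withinI)
    qed
    have int: "(\<lambda>t. t ^ n * f (?s z t)) integrable_on cbox 0 1" if "z \<in> ball a R" for z
    proof -
      have "continuous_on (cbox 0 1) (\<lambda>t. ?s z t)" by (intro continuous_intros)
      with contf have "continuous_on (cbox 0 1) (\<lambda>t. f (?s z t))"
        using segment_map_in_ball(2)[OF z0 that] by (rule continuous_on_compose2)
      then show ?thesis by (intro integrable_continuous continuous_intros)
    qed
    have "(?F has_derivative blinfun_apply (integral (cbox 0 1) (?fx z))) (at z within ball a R)"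
      by (rule leibniz_rule[OF fder int cont z convex_ball])
    then have 1: "(?F has_derivative blinfun_apply (integral (cbox 0 1) (?fx z))) (at z)"
      using z by (simp add: at_within_open[of z "ball a R"])
    have intfx: "?fx z integrable_on cbox 0 1"
    proof (rule integrable_continuous)
      show "continuous_on (cbox 0 1) (?fx z)"
        using continuous_on_compose2[OF cont, of "cbox 0 1" "\<lambda>t. (z, t)"] z
        by (simp add: continuous_on_Pair image_subset_iff del: power_Suc)
    qed
    have "blinfun_apply (integral (cbox 0 1) (?fx z)) =
        (\<lambda>v. integral (cbox 0 1) (\<lambda>t. t ^ Suc n * frechet_derivative f (at (?s z t)) v))"
    proof
      fix v
      have "blinfun_apply (integral (cbox 0 1) (?fx z)) v = integral (cbox 0 1) (\<lambda>t. blinfun_apply (?fx z t) v)"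
        using integral_linear[OF intfx blinfun.bounded_linear_left] by (simp add: o_def)
      also have "\<dots> = integral (cbox 0 1) (\<lambda>t. t ^ Suc n * frechet_derivative f (at (?s z t)) v)"
        proof (rule integral_cong)
          fix t :: real assume "t \<in> cbox 0 1"
          then have "?s z t \<in> ball a R" using segment_in_ball[OF z0 z] by (simp only: box_real)
          from B[OF this] show "blinfun_apply (?fx z t) v = t ^ Suc n * frechet_derivative f (at (?s z t)) v"
            by (simp add: blinfun.scaleR_left)
        qed
      finally show "blinfun_apply (integral (cbox 0 1) (?fx z)) v =
        integral (cbox 0 1) (\<lambda>t. t ^ Suc n * frechet_derivative f (at (?s z t)) v)" .
    qed
    with 1 show "((\<lambda>z. integral {0..1} (\<lambda>t. t ^ n * f (?s z t))) has_derivative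
        (\<lambda>v. integral {0..1} (\<lambda>t. t ^ Suc n * frechet_derivative f (at (?s z t)) v))) (at z)"
      by (simp only: box_real)
  qed auto
qed

text \<open>
  The functions \<open>G b\<close> are the integrals of the directional derivatives along the segment from \<open>z0\<close> to
  \<open>z\<close>. The expansion holds for every finite family \<open>B\<close> that spans the displacement, because a chart takes
  values in a subspace and only displacements within that subspace are of interest.
\<close>

lemma Hadamard:
  fixes f :: "'a::euclidean_space \<Rightarrow> real"
  assumes z0: "z0 \<in> ball a R" and f: "\<And>k. Ck_on k (ball a R) f"
  obtains G where "\<And>b k. Ck_on k (ball a R) (G b)"
    "\<And>b. G b z0 = frechet_derivative f (at z0) b"
    "\<And>z c B. z \<in> ball a R \<Longrightarrow> finite B \<Longrightarrow> z - z0 = (\<Sum>b\<in>B. c b *\<^sub>R b) \<Longrightarrow>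
       f z - f z0 = (\<Sum>b\<in>B. c b * G b z)"
proof
  let ?G = "\<lambda>b z. integral {0..1} (\<lambda>t. t ^ 0 * frechet_derivative f (at (z0 + t *\<^sub>R (z - z0))) b)"
  show "Ck_on k (ball a R) (?G b)" for b k
    using Ck_on_segment_integral[OF z0, of "\<lambda>y. frechet_derivative f (at y) b" k 0]
      Ck_on_all_derivative[of "ball a R" f] f by blast
  show "?G b z0 = frechet_derivative f (at z0) b" for b by simp
  fix z c and B :: "'a set" assume z: "z \<in> ball a R" and B: "finite B" and eq: "z - z0 = (\<Sum>b\<in>B. c b *\<^sub>R b)"
  let ?D = "\<lambda>t. frechet_derivative f (at (z0 + t *\<^sub>R (z - z0)))"
  have df: "(f has_derivative ?D t) (at (z0 + t *\<^sub>R (z - z0)))" if "t \<in> {0..1}" for t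
    using Ck_on_derivative[OF f] segment_in_ball[OF z0 z that] by blast
  have "((\<lambda>t. f (z0 + t *\<^sub>R (z - z0))) has_vector_derivative ?D t (z - z0)) (at t within {0..1})"
    if "t \<in> {0..1}" for t
  proof -
    have "((\<lambda>t. z0 + t *\<^sub>R (z - z0)) has_derivative (\<lambda>s. s *\<^sub>R (z - z0))) (at t)"
      by (auto intro!: derivative_eq_intros)
    from has_derivative_compose[OF this df[OF that]]
    show ?thesis
      using linear_scale[OF has_derivative_linear[OF df[OF that]]]
      by (simp add: has_vector_derivative_def has_derivative_at_withinI)
  qed
  then have "((\<lambda>t. ?D t (z - z0)) has_integral (f z - f z0)) {0..1}"
    using fundamental_theorem_of_calculus[of 0 1 "\<lambda>t. f (z0 + t *\<^sub>R (z - z0))" "\<lambda>t. ?D t (z - z0)"] by simp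
  then have "f z - f z0 = integral {0..1} (\<lambda>t. ?D t (z - z0))"
    by (simp add: integral_unique)
  also have "\<dots> = integral {0..1} (\<lambda>t. \<Sum>b\<in>B. c b * ?D t b)"
  proof (rule integral_cong)
    fix t :: real assume t: "t \<in> {0..1}"
    interpret linear "?D t" using df[OF t] has_derivative_linear by blast
    have "?D t (\<Sum>b\<in>B. c b *\<^sub>R b) = (\<Sum>b\<in>B. c b * ?D t b)" by (simp add: sum scale)
    with arg_cong[OF eq, of "?D t"] show "?D t (z - z0) = (\<Sum>b\<in>B. c b * ?D t b)" by (rule trans)
  qed
  also have "\<dots> = (\<Sum>b\<in>B. c b * integral {0..1} (\<lambda>t. ?D t b))"
  proof (subst integral_sum[OF B])
    fix b
    have "continuous_on (ball a R) (\<lambda>y. frechet_derivative f (at y) b)"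
      using f[of 1] by simp
    moreover have "continuous_on (cbox 0 (1::real)) (\<lambda>t. z0 + t *\<^sub>R (z - z0))"
      by (intro continuous_intros)
    ultimately have "continuous_on (cbox 0 1) (\<lambda>t. ?D t b)"
      using segment_map_in_ball(2)[OF z0 z] by (rule continuous_on_compose2)
    then have "continuous_on {0..1} (\<lambda>t. c b * ?D t b)"
      unfolding box_real by (intro continuous_intros)
    then show "(\<lambda>t. c b * ?D t b) integrable_on {0..1}" by (rule integrable_continuous_real)
  qed simp
  finally show "f z - f z0 = (\<Sum>b\<in>B. c b * ?G b z)" by simp
qed

section \<open>Smooth functions and coordinate balls\<close>

text \<open>
  \<open>B\<close> is an orthonormal basis of the space \<open>E\<close> in which the charts take their values. The orthogonal
  projection onto \<open>E\<close> extends functions on relatively open subsets of \<open>E\<close> to open subsets of the ambient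
  space, where the calculus above applies.
\<close>

locale smooth_manifold =
  fixes E :: "'e::euclidean_space set"
    and A :: "('m::{t2_space,second_countable_topology}, 'e) chart set"
    and B :: "'e set"
  assumes atlas: "smooth_atlas E A"
    and finite_B: "finite B"
    and span_B: "span B = E"
    and orthonormal_B: "\<And>b c. b \<in> B \<Longrightarrow> c \<in> B \<Longrightarrow> b \<bullet> c = (if b = c then 1 else 0)"
begin

definition proj :: "'e \<Rightarrow> 'e" where
  "proj z = (\<Sum>b\<in>B. (z \<bullet> b) *\<^sub>R b)"

lemma proj_in_E: "proj z \<in> E"
  unfolding proj_def span_B[symmetric] by (intro span_sum span_scale span_base)

lemma bounded_linear_proj: "bounded_linear proj"
  unfolding proj_def
  by (intro bounded_linear_sum bounded_linear_scaleR_const bounded_linear_inner_left)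

lemma proj_basis: "c \<in> B \<Longrightarrow> proj c = c"
  unfolding proj_def
  using finite_B by (simp add: orthonormal_B if_distrib[of "\<lambda>t. t *\<^sub>R _"] cong: if_cong)

lemma proj_eq: "z \<in> E \<Longrightarrow> proj z = z"
  using span_B linear_eq_on[of proj "\<lambda>z. z" z B] bounded_linear_proj proj_basis
  by (metis bounded_linear.linear linear_id id_def eq_id_iff)

lemma subspace_E: "subspace E"
  using span_B subspace_span by metis

lemma Ck_on_proj: "open U \<Longrightarrow> Ck_on k U proj"
  by (rule Ck_on_linear[OF _ bounded_linear_proj])

lemma open_vimage_proj: "openin (top_of_set E) S \<Longrightarrow> open (proj -` S)"
proof -
  assume "openin (top_of_set E) S"
  then obtain T where T: "open T" "S = E \<inter> T" by (auto simp: openin_open)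
  then have "proj -` S = proj -` T" using proj_in_E by auto
  moreover have "open (proj -` T)"
    using T bounded_linear_proj by (intro open_vimage linear_continuous_on) auto
  ultimately show ?thesis by simp
qed

text \<open>
  Smoothness on a relatively open set is defined by local extensions that vary from point to point.
  Composition with the projection provides one extension to an open set that serves for all of them.
\<close>

lemma smooth_on_iff:
  assumes "openin (top_of_set E) S"
  shows "smooth_on S g \<longleftrightarrow> (\<forall>k. Ck_on k (proj -` S) (\<lambda>z. g (proj z)))"
proof
  assume sm: "smooth_on S g"
  show "\<forall>k. Ck_on k (proj -` S) (\<lambda>z. g (proj z))"
  proof (intro allI Ck_on_local)
    fix k z assume z: "z \<in> proj -` S"
    then obtain V h where V: "open V" "proj z \<in> V" "\<And>k. Ck_on k V h" "\<And>y. y \<in> S \<inter> V \<Longrightarrow> g y = h y"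
      using sm unfolding smooth_on_def by fastforce
    let ?W = "proj -` V \<inter> proj -` S"
    have W: "open ?W"
      using open_vimage_proj[OF assms] open_vimage[OF V(1) linear_continuous_on[OF bounded_linear_proj]]
      by (rule open_Int[rotated])
    have "Ck_on k ?W (\<lambda>z. h (proj z))"
      by (rule Ck_on_compose[OF W V(1) V(3) Ck_on_proj[OF W]]) auto
    then have "Ck_on k ?W (\<lambda>z. g (proj z))"
      by (rule Ck_on_cong[OF W, rotated]) (use V(4) in auto)
    then show "\<exists>V. open V \<and> z \<in> V \<and> Ck_on k V (\<lambda>z. g (proj z))"
      using W z V(2) by auto
  qed
next
  assume Ck: "\<forall>k. Ck_on k (proj -` S) (\<lambda>z. g (proj z))"
  have "S \<subseteq> E" using assms openin_imp_subset by blast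
  then show "smooth_on S g"
    unfolding smooth_on_def using Ck open_vimage_proj[OF assms] proj_eq
    by (intro ballI exI[of _ "proj -` S"] exI[of _ "\<lambda>z. g (proj z)"]) auto
qed

abbreviation "SF \<equiv> smooth_functions A"
abbreviation "T p \<equiv> tangent_space A p"
abbreviation "VF \<equiv> vector_fields A"

text \<open>
  The expression of \<open>f\<close> in a chart, extended to be constant along the orthogonal complement of \<open>E\<close>.
\<close>

definition lift :: "'m set \<Rightarrow> ('m \<Rightarrow> 'e) \<Rightarrow> ('m \<Rightarrow> 'b) \<Rightarrow> 'e \<Rightarrow> 'b" where
  "lift U \<phi> f z = f (inv_into U \<phi> (proj z))"

context
  fixes U \<phi> assumes chart: "(U, \<phi>) \<in> A"
begin

lemma chart_open: "open U"
  and chart_image_openin: "openin (top_of_set E) (\<phi> ` U)"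
  and chart_homeomorphism: "homeomorphism U (\<phi> ` U) \<phi> (inv_into U \<phi>)"
  using atlas chart unfolding smooth_atlas_def by auto

lemma chart_inv: "q \<in> U \<Longrightarrow> inv_into U \<phi> (\<phi> q) = q"
  using chart_homeomorphism by (auto simp: homeomorphism_def)

lemma chart_in_E: "q \<in> U \<Longrightarrow> \<phi> q \<in> E"
  using openin_imp_subset[OF chart_image_openin] by auto

lemma proj_chart: "q \<in> U \<Longrightarrow> proj (\<phi> q) = \<phi> q"
  using chart_in_E proj_eq by auto

lemma lift_chart: "q \<in> U \<Longrightarrow> lift U \<phi> f (\<phi> q) = f q"
  by (simp add: lift_def proj_chart chart_inv)

lemma chart_image_open:
  assumes "open W" "W \<subseteq> U"
  shows "openin (top_of_set E) (\<phi> ` W)"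
proof -
  have "openin (top_of_set U) W" using assms by (simp add: open_subset)
  then have "openin (top_of_set (\<phi> ` U)) (\<phi> ` W)"
    using homeomorphism_imp_open_map[OF chart_homeomorphism] by blast
  then show ?thesis using chart_image_openin openin_trans by blast
qed

lemmas open_chart_domain = open_vimage_proj[OF chart_image_open]

lemma Ck_on_lift_transition:
  assumes "(V, \<psi>) \<in> A"
  shows "Ck_on k (proj -` (\<phi> ` (U \<inter> V))) (lift U \<phi> \<psi>)"
proof -
  have "smooth_on (\<phi> ` (U \<inter> V)) (\<psi> \<circ> inv_into U \<phi>)"
    using atlas chart assms unfolding smooth_atlas_def by fast
  moreover have "open V" using atlas assms unfolding smooth_atlas_def by auto
  ultimately show ?thesis
    using smooth_on_iff[OF chart_image_open, of "U \<inter> V" "\<psi> \<circ> inv_into U \<phi>"] chart_open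
    by (auto simp: lift_def[abs_def])
qed

end

lemma smooth_functions_iff:
  "f \<in> SF \<longleftrightarrow> (\<forall>(U, \<phi>)\<in>A. \<forall>k. Ck_on k (proj -` (\<phi> ` U)) (lift U \<phi> f))"
proof -
  have "smooth_on (\<phi> ` U) (f \<circ> inv_into U \<phi>) \<longleftrightarrow> (\<forall>k. Ck_on k (proj -` (\<phi> ` U)) (lift U \<phi> f))"
    if "(U, \<phi>) \<in> A" for U \<phi>
    using smooth_on_iff[OF chart_image_openin[OF that], of "f \<circ> inv_into U \<phi>"]
    by (simp add: lift_def[abs_def])
  then show ?thesis unfolding smooth_functions_def by blast
qed

lemma Ck_on_lift:
  "f \<in> SF \<Longrightarrow> (U, \<phi>) \<in> A \<Longrightarrow> Ck_on k (proj -` (\<phi> ` U)) (lift U \<phi> f)"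
  using smooth_functions_iff by blast

lemma smooth_functionsI:
  "(\<And>U \<phi> k. (U, \<phi>) \<in> A \<Longrightarrow> Ck_on k (proj -` (\<phi> ` U)) (lift U \<phi> f)) \<Longrightarrow> f \<in> SF"
  using smooth_functions_iff by blast

lemma smooth_const [simp, intro]: "(\<lambda>x. c) \<in> SF"
  by (rule smooth_functionsI)
    (simp add: lift_def[abs_def] Ck_on_const open_vimage_proj chart_image_openin)

lemma smooth_add [intro]: "f \<in> SF \<Longrightarrow> g \<in> SF \<Longrightarrow> (\<lambda>x. f x + g x) \<in> SF"
  using Ck_on_add[OF open_vimage_proj[OF chart_image_openin] Ck_on_lift Ck_on_lift]
  by (intro smooth_functionsI) (auto simp: lift_def[abs_def])

lemma smooth_mult [intro]: "f \<in> SF \<Longrightarrow> g \<in> SF \<Longrightarrow> (\<lambda>x. f x * g x) \<in> SF"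
  using Ck_on_mult[OF open_vimage_proj[OF chart_image_openin] Ck_on_lift Ck_on_lift]
  by (intro smooth_functionsI) (auto simp: lift_def[abs_def])

lemma smooth_uminus [intro]: "f \<in> SF \<Longrightarrow> (\<lambda>x. - f x) \<in> SF"
  using smooth_mult[OF smooth_const[of "-1"]] by simp

lemma smooth_diff [intro]: "f \<in> SF \<Longrightarrow> g \<in> SF \<Longrightarrow> (\<lambda>x. f x - g x) \<in> SF"
  using smooth_add[OF _ smooth_uminus] by simp

lemma smooth_sum [intro]: "(\<And>i. i \<in> I \<Longrightarrow> f i \<in> SF) \<Longrightarrow> (\<lambda>x. \<Sum>i\<in>I. f i x) \<in> SF"
  by (induction I rule: infinite_finite_induct) auto

lemma smooth_power [intro]: "f \<in> SF \<Longrightarrow> (\<lambda>x. f x ^ n) \<in> SF"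
  by (induction n) auto

section \<open>Derivations\<close>

context
  fixes p v assumes v: "v \<in> T p"
begin

lemma tangent_add: "f \<in> SF \<Longrightarrow> g \<in> SF \<Longrightarrow> v (\<lambda>x. f x + g x) = v f + v g"
  and tangent_scale: "f \<in> SF \<Longrightarrow> v (\<lambda>x. c * f x) = c * v f"
  and tangent_mult: "f \<in> SF \<Longrightarrow> g \<in> SF \<Longrightarrow> v (\<lambda>x. f x * g x) = f p * v g + g p * v f"
  and tangent_nonsmooth: "f \<notin> SF \<Longrightarrow> v f = 0"
  using v unfolding tangent_space_def by auto

lemma tangent_const [simp]: "v (\<lambda>x. c) = 0"
proof -
  have "v (\<lambda>x. 1 * 1) = 1 * v (\<lambda>x. 1) + 1 * v (\<lambda>x. 1)"
    by (intro tangent_mult) auto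
  then have "v (\<lambda>x. 1) = 0" by simp
  then show ?thesis using tangent_scale[OF smooth_const[of 1], of c] by simp
qed

lemma tangent_diff: "f \<in> SF \<Longrightarrow> g \<in> SF \<Longrightarrow> v (\<lambda>x. f x - g x) = v f - v g"
  using tangent_add[of f "\<lambda>x. (-1) * g x"] tangent_scale[of g "-1"] smooth_uminus[of g] by simp

lemma tangent_sum: "(\<And>i. i \<in> I \<Longrightarrow> f i \<in> SF) \<Longrightarrow> v (\<lambda>x. \<Sum>i\<in>I. f i x) = (\<Sum>i\<in>I. v (f i))"
  by (induction I rule: infinite_finite_induct) (auto simp: tangent_add smooth_sum)

end

end

section \<open>The local frame\<close>

text \<open>
  A ball in the range of a chart, with some room around it: bumps are supported in the closed ball of
  radius \<open>r\<close>, while the functions that they multiply only have to be smooth on the ball of radius \<open>R\<close>.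
\<close>

locale coordinate_ball = smooth_manifold E A B
  for E :: "'e::euclidean_space set"
    and A :: "('m::{t2_space,second_countable_topology}, 'e) chart set"
    and B :: "'e set" +
  fixes U :: "'m set" and \<phi> :: "'m \<Rightarrow> 'e" and a :: 'e and r R :: real
  assumes chart: "(U, \<phi>) \<in> A"
    and r_pos: "0 < r" and r_less: "r < R"
    and ball_subset: "ball a R \<subseteq> proj -` (\<phi> ` U)"
begin

text \<open>
  The bump vanishes outside the ball of radius \<open>r\<close>, so extension by zero preserves smoothness, and the
  values of \<open>F\<close> far from \<open>a\<close> are irrelevant.
\<close>

definition extend :: "('e \<Rightarrow> real) \<Rightarrow> 'm \<Rightarrow> real" where
  "extend F q = (if q \<in> U then bump a r (\<phi> q) * F (\<phi> q) else 0)"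

lemma extend_eq_0: "\<not> (q \<in> U \<and> \<phi> q \<in> ball a r) \<Longrightarrow> extend F q = 0"
  using bump_eq_0_iff[OF r_pos] by (auto simp: extend_def)

text \<open>
  The set is the image of a compact set under the inverse chart, and compact sets are closed in a
  Hausdorff space. Closedness in the chart domain alone would not make extension by zero smooth.
\<close>

lemma closed_support: "closed {q \<in> U. \<phi> q \<in> cball a r}"
proof -
  have sub: "cball a r \<inter> E \<subseteq> \<phi> ` U"
  proof
    fix z assume z: "z \<in> cball a r \<inter> E"
    then have "z \<in> ball a R" using r_less by auto
    then have "proj z \<in> \<phi> ` U" using ball_subset by blast
    then show "z \<in> \<phi> ` U" using z proj_eq by simp
  qed
  have "compact (cball a r \<inter> E)"
    using closed_subspace[OF subspace_E] by (simp add: compact_Int_closed)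
  moreover have "continuous_on (cball a r \<inter> E) (inv_into U \<phi>)"
    using chart_homeomorphism[OF chart] sub by (meson continuous_on_subset homeomorphism_def)
  ultimately have "compact (inv_into U \<phi> ` (cball a r \<inter> E))"
    by (rule compact_continuous_image[rotated])
  moreover have "inv_into U \<phi> ` (cball a r \<inter> E) = {q \<in> U. \<phi> q \<in> cball a r}"
  proof (intro equalityI subsetI)
    fix q assume "q \<in> inv_into U \<phi> ` (cball a r \<inter> E)"
    then obtain z where z: "z \<in> cball a r \<inter> E" "q = inv_into U \<phi> z" by blast
    then have "z \<in> \<phi> ` U" using sub by blast
    then have "q \<in> U" "\<phi> q = z" using z(2) by (simp_all add: inv_into_into f_inv_into_f)
    then show "q \<in> {q \<in> U. \<phi> q \<in> cball a r}" using z by simp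
  next
    fix q assume "q \<in> {q \<in> U. \<phi> q \<in> cball a r}"
    then show "q \<in> inv_into U \<phi> ` (cball a r \<inter> E)"
      using chart_inv[OF chart] chart_in_E[OF chart] by (auto intro!: image_eqI[of _ _ "\<phi> q"] simp del: mem_cball)
  qed
  ultimately show ?thesis by (simp add: compact_imp_closed)
qed

lemma open_ball_domain: "open {q \<in> U. \<phi> q \<in> ball a s}"
proof -
  have "continuous_on U \<phi>" using chart_homeomorphism[OF chart] homeomorphism_def by blast
  then have "open (\<phi> -` ball a s \<inter> U)"
    using continuous_on_open_vimage[OF chart_open[OF chart]] by blast
  then show ?thesis by (simp add: vimage_def Int_def conj_commute)
qed

lemma extend_smooth:
  assumes F: "\<And>k. Ck_on k (ball a R) F"
  shows "extend F \<in> SF"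
proof (rule smooth_functionsI, rule Ck_on_local)
  fix V \<psi> k z assume V: "(V, \<psi>) \<in> A" and z: "z \<in> proj -` (\<psi> ` V)"
  define q where "q = inv_into V \<psi> (proj z)"
  have q: "q \<in> V" "\<psi> q = proj z" using z by (auto simp: q_def inv_into_into f_inv_into_f)
  \<comment> \<open>Near a point of the support the function is a composition with the transition map; off the closed support it is zero.\<close>
  show "\<exists>W. open W \<and> z \<in> W \<and> Ck_on k W (lift V \<psi> (extend F))"
  proof (cases "q \<in> U \<and> \<phi> q \<in> cball a r")
    case True
    define W where "W = V \<inter> {q \<in> U. \<phi> q \<in> ball a R}"
    let ?W = "proj -` (\<psi> ` W)"
    have oW: "open ?W"
      using open_ball_domain chart_open[OF V] by (intro open_chart_domain[OF V]) (auto simp: W_def)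
    have inW: "inv_into V \<psi> (proj y) \<in> W" if "y \<in> ?W" for y
      using that chart_inv[OF V] by (auto simp: W_def)
    have "Ck_on k ?W (lift V \<psi> \<phi>)"
      by (rule Ck_on_subset[OF Ck_on_lift_transition[OF V chart]]) (auto simp: W_def)
    moreover have "lift V \<psi> \<phi> ` ?W \<subseteq> ball a R" 
      by (rule image_subsetI, drule inW) (simp add: lift_def W_def)
    moreover have "Ck_on k (ball a R) (\<lambda>z. bump a r z * F z)"
      by (intro Ck_on_mult Ck_on_bump F open_ball)
    ultimately have "Ck_on k ?W (\<lambda>y. bump a r (lift V \<psi> \<phi> y) * F (lift V \<psi> \<phi> y))"
      using Ck_on_compose[OF oW open_ball] by blast
    then have "Ck_on k ?W (lift V \<psi> (extend F))"
      by (rule Ck_on_cong[OF oW, rotated]) (use inW in \<open>auto simp: lift_def extend_def W_def\<close>)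
    moreover have "z \<in> ?W" using True q r_less by (auto simp: W_def intro!: image_eqI[of _ _ q])
    ultimately show ?thesis using oW by blast
  next
    case False
    define W where "W = V - {q \<in> U. \<phi> q \<in> cball a r}"
    let ?W = "proj -` (\<psi> ` W)"
    have oW: "open ?W"
      using closed_support chart_open[OF V] by (intro open_chart_domain[OF V]) (auto simp: W_def)
    have inW: "inv_into V \<psi> (proj y) \<in> W" if "y \<in> ?W" for y
      using that chart_inv[OF V] by (auto simp: W_def)
    have "0 = lift V \<psi> (extend F) y" if "y \<in> ?W" for y
      unfolding lift_def by (rule extend_eq_0[symmetric]) (use inW[OF that] in \<open>auto simp: W_def\<close>)
    then have "Ck_on k ?W (lift V \<psi> (extend F))"
      by (rule Ck_on_cong[OF oW _ Ck_on_const[OF oW]])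
    moreover have "z \<in> ?W" using False q by (auto simp: W_def intro!: image_eqI[of _ _ q])
    ultimately show ?thesis using oW by blast
  qed
qed

definition rho :: "'m \<Rightarrow> real" where
  "rho = extend (\<lambda>z. 1)"

definition coord :: "'e \<Rightarrow> 'm \<Rightarrow> real" where
  "coord b = extend (\<lambda>z. z \<bullet> b)"

definition partial :: "('m \<Rightarrow> real) \<Rightarrow> 'e \<Rightarrow> 'e \<Rightarrow> real" where
  "partial f b z = frechet_derivative (lift U \<phi> f) (at z) b"

text \<open>
  The coordinate fields multiplied by the bump. The value 0 on non-smooth functions is part of being a
  tangent vector.
\<close>

definition frame :: "'e \<Rightarrow> 'm \<Rightarrow> 'm tvec" where
  "frame b q f = (if f \<in> SF then extend (partial f b) q else 0)"

lemma rho_smooth: "rho \<in> SF"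
  unfolding rho_def by (rule extend_smooth) (simp add: Ck_on_const)

lemma coord_smooth: "coord b \<in> SF"
  unfolding coord_def
  by (rule extend_smooth) (simp add: Ck_on_linear bounded_linear_inner_left)

lemma rho_neq_0_iff: "rho q \<noteq> 0 \<longleftrightarrow> q \<in> U \<and> \<phi> q \<in> ball a r"
  using bump_eq_0_iff[OF r_pos] by (auto simp: extend_def rho_def)

lemma extend_eq: "extend F q = rho q * F (\<phi> q)"
  by (simp add: extend_def rho_def)

lemma coord_eq: "coord b q = rho q * (\<phi> q \<bullet> b)"
  by (simp add: coord_def extend_eq)

lemma Ck_on_lift_ball: "f \<in> SF \<Longrightarrow> Ck_on k (ball a R) (lift U \<phi> f)"
  using Ck_on_lift[OF _ chart] ball_subset Ck_on_subset by blast

lemma lift_has_derivative: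
  assumes "f \<in> SF" "z \<in> proj -` (\<phi> ` U)"
  shows "(lift U \<phi> f has_derivative (\<lambda>b. partial f b z)) (at z)"
  using Ck_on_derivative[OF Ck_on_lift[OF assms(1) chart] assms(2)] by (simp add: partial_def)

lemma partial_eqI:
  assumes "(lift U \<phi> f has_derivative D) (at z)"
  shows "partial f b z = D b"
  using frechet_derivative_at[OF assms] by (simp add: partial_def)

lemma frame_vector_field: "frame b \<in> VF"
proof -
  have smooth: "(\<lambda>p. frame b p f) \<in> SF" if f: "f \<in> SF" for f
  proof -
    have "Ck_on k (ball a R) (partial f b)" for k
      using Ck_on_all_derivative[of "ball a R" "lift U \<phi> f"] Ck_on_lift_ball[OF f]
      by (simp add: partial_def[abs_def])
    then have "extend (partial f b) \<in> SF" by (rule extend_smooth)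
    then show ?thesis using f by (simp add: frame_def[abs_def])
  qed
  have tangent: "frame b q \<in> T q" for q
  proof (cases "q \<in> U")
    case False
    then show ?thesis by (simp add: tangent_space_def frame_def extend_def)
  next
    case True
    have z: "\<phi> q \<in> proj -` (\<phi> ` U)" using True proj_chart[OF chart] by simp
    note d = lift_has_derivative[OF _ z]
    have add: "partial (\<lambda>x. f x + g x) b (\<phi> q) = partial f b (\<phi> q) + partial g b (\<phi> q)" if "f \<in> SF" "g \<in> SF" for f g
      using has_derivative_add[OF d d, OF that] by (intro partial_eqI) (simp add: lift_def[abs_def])
    have scale: "partial (\<lambda>x. c * f x) b (\<phi> q) = c * partial f b (\<phi> q)" if "f \<in> SF" for f c
      using has_derivative_mult_right[OF d, OF that, of c] by (intro partial_eqI) (simp add: lift_def[abs_def])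
    have mult: "partial (\<lambda>x. f x * g x) b (\<phi> q) = f q * partial g b (\<phi> q) + g q * partial f b (\<phi> q)" if "f \<in> SF" "g \<in> SF" for f g
    proof -
      have "partial (\<lambda>x. f x * g x) b (\<phi> q) =
          lift U \<phi> f (\<phi> q) * partial g b (\<phi> q) + partial f b (\<phi> q) * lift U \<phi> g (\<phi> q)"
        using has_derivative_mult[OF d d, OF that] by (intro partial_eqI) (simp add: lift_def[abs_def])
      then show ?thesis by (simp add: lift_chart[OF chart True] mult.commute)
    qed
    show ?thesis
      unfolding tangent_space_def
      by (auto simp: frame_def extend_eq add scale mult smooth_mult smooth_add algebra_simps
          intro: smooth_mult[OF smooth_const])
  qed
  from smooth tangent show ?thesis by (simp add: vector_fields_def)
qed

text \<open>
  Hadamard's lemma, multiplied by the square of the bump, is an identity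
  \<open>\<rho>\<^sup>2 (f - f(q)) = \<Sum>\<^sub>b (y\<^sub>b - c\<^sub>b \<rho>) G\<^sub>b\<close> between global smooth functions, where \<open>y\<^sub>b\<close> is the coordinate function times
  \<open>\<rho>\<close> and \<open>c\<^sub>b\<close> is the \<open>b\<close>-th coordinate of \<open>q\<close>. Each factor \<open>y\<^sub>b - c\<^sub>b \<rho>\<close> vanishes at \<open>q\<close>, so that applying a derivation at \<open>q\<close>
  leaves only \<open>G\<^sub>b(q)\<close>, a partial derivative of \<open>f\<close>. The right-hand side is written with \<open>v \<rho>\<close> and \<open>v y\<^sub>b\<close>
  in such a way that it makes sense, and is smooth when \<open>v\<close> varies in a vector field, on the whole
  manifold.
\<close>

lemma frame_expansion:
  assumes v: "v \<in> T q" and f: "f \<in> SF"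
  shows "rho q ^ 3 * v f = (\<Sum>b\<in>B. (rho q * v (coord b) - coord b q * v rho) * frame b q f)"
proof (cases "rho q = 0")
  case True
  then show ?thesis by (simp add: frame_def extend_eq f)
next
  case False
  then have qU: "q \<in> U" and qb: "\<phi> q \<in> ball a r" using rho_neq_0_iff by auto
  define z0 where "z0 = \<phi> q"
  have z0: "z0 \<in> ball a R" using qb r_less by (auto simp: z0_def)
  obtain G where G: "\<And>b k. Ck_on k (ball a R) (G b)" "\<And>b. G b z0 = partial f b z0"
    and eq: "\<And>z c B. z \<in> ball a R \<Longrightarrow> finite B \<Longrightarrow> z - z0 = (\<Sum>b\<in>B. c b *\<^sub>R b) \<Longrightarrow>
       lift U \<phi> f z - lift U \<phi> f z0 = (\<Sum>b\<in>B. c b * G b z)"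
    using Hadamard[OF z0 Ck_on_lift_ball[OF f]] unfolding partial_def by blast
  have G_smooth: "extend (G b) \<in> SF" for b using G(1) by (rule extend_smooth)
  let ?h = "\<lambda>b x. coord b x - (z0 \<bullet> b) * rho x"
  have h_smooth: "?h b \<in> SF" for b
    by (intro smooth_diff smooth_mult coord_smooth rho_smooth smooth_const)
  have dec: "(rho x * rho x) * (f x - f q) = (\<Sum>b\<in>B. ?h b x * extend (G b) x)" for x
  proof (cases "rho x = 0")
    case True
    then show ?thesis by (simp add: extend_eq)
  next
    case False
    then have xU: "x \<in> U" and xb: "\<phi> x \<in> ball a R" using rho_neq_0_iff r_less by auto
    have "\<phi> x - z0 \<in> E"
      using subspace_diff[OF subspace_E] chart_in_E[OF chart] xU qU z0_def by simp
    then have "\<phi> x - z0 = (\<Sum>b\<in>B. ((\<phi> x - z0) \<bullet> b) *\<^sub>R b)"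
      using proj_eq[of "\<phi> x - z0"] by (simp add: proj_def)
    from eq[OF xb finite_B this]
    have "f x - f q = (\<Sum>b\<in>B. ((\<phi> x - z0) \<bullet> b) * G b (\<phi> x))"
      by (simp add: z0_def lift_chart[OF chart xU] lift_chart[OF chart qU])
    then show ?thesis
      by (simp add: extend_eq coord_eq sum_distrib_left algebra_simps)
  qed
  have "rho q * rho q * v f = v (\<lambda>x. (rho x * rho x) * (f x - f q))"
    by (subst tangent_mult[OF v]) (auto simp: rho_smooth f tangent_diff[OF v] tangent_const[OF v])
  also have "\<dots> = (\<Sum>b\<in>B. v (\<lambda>x. ?h b x * extend (G b) x))"
    unfolding dec by (rule tangent_sum[OF v]) (intro smooth_mult h_smooth G_smooth)
  also have "\<dots> = (\<Sum>b\<in>B. (v (coord b) - (z0 \<bullet> b) * v rho) * frame b q f)"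
  proof (rule sum.cong[OF refl])
    fix b
    have "v (\<lambda>x. ?h b x * extend (G b) x) = ?h b q * v (extend (G b)) + extend (G b) q * v (?h b)"
      by (rule tangent_mult[OF v h_smooth G_smooth])
    moreover have "?h b q = 0" by (simp add: coord_eq extend_eq z0_def)
    moreover have "v (?h b) = v (coord b) - (z0 \<bullet> b) * v rho"
      using smooth_mult[OF smooth_const rho_smooth]
      by (simp add: tangent_diff[OF v] tangent_scale[OF v] coord_smooth rho_smooth)
    moreover have "extend (G b) q = frame b q f" using f G(2)[of b] by (simp add: frame_def extend_eq z0_def)
    ultimately show "v (\<lambda>x. ?h b x * extend (G b) x) = (v (coord b) - (z0 \<bullet> b) * v rho) * frame b q f"
      by (simp add: mult.commute)
  qed
  finally have "rho q * (rho q * rho q * v f) =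
      (\<Sum>b\<in>B. rho q * ((v (coord b) - (z0 \<bullet> b) * v rho) * frame b q f))"
    by (simp add: sum_distrib_left)
  also have "\<dots> = (\<Sum>b\<in>B. (rho q * v (coord b) - coord b q * v rho) * frame b q f)"
    by (rule sum.cong[OF refl]) (simp add: coord_eq extend_eq z0_def algebra_simps)
  finally show ?thesis by (simp add: power3_eq_cube mult.assoc)
qed

text \<open>
  The coefficient functional of \<open>frame_expansion\<close> at index \<open>b\<close> takes the value \<open>\<rho>\<^sup>3\<close> on the \<open>b\<close>-th frame field.
  In particular that field has no zeros where \<open>\<rho>\<close> is nonzero, and if a tensor multiplies it by a scalar,
  then that scalar times \<open>\<rho>\<^sup>3\<close> is a smooth function.
\<close>

lemma frame_dual:
  assumes "b \<in> B"
  shows "rho q * frame b q (coord b) - coord b q * frame b q rho = rho q ^ 3"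
proof (cases "rho q = 0")
  case True
  then show ?thesis by (simp add: frame_def extend_eq coord_eq)
next
  case False
  then have qU: "q \<in> U" and qb: "\<phi> q \<in> ball a r" using rho_neq_0_iff by auto
  let ?z = "\<phi> q"
  have z: "?z \<in> proj -` (\<phi> ` U)" using qU proj_chart[OF chart] by simp
  have W: "open (proj -` (\<phi> ` U))" by (rule open_vimage_proj[OF chart_image_openin[OF chart]])
  (* on the chart domain, coord b is rho times the linear function of proj z *)
  have lc: "lift U \<phi> (coord b) y = lift U \<phi> rho y * (proj y \<bullet> b)" if "y \<in> proj -` (\<phi> ` U)" for y
    using that by (auto simp: lift_def coord_eq f_inv_into_f)
  note dr = lift_has_derivative[OF rho_smooth z]
  have dp: "((\<lambda>y. proj y \<bullet> b) has_derivative (\<lambda>y. proj y \<bullet> b)) (at ?z)"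
    by (intro bounded_linear_imp_has_derivative bounded_linear_inner_left_comp bounded_linear_proj)
  have "(lift U \<phi> (coord b) has_derivative (\<lambda>c. lift U \<phi> rho ?z * (proj c \<bullet> b) + partial rho c ?z * (proj ?z \<bullet> b))) (at ?z)"
    by (rule has_derivative_transform_within_open[OF has_derivative_mult[OF dr dp] W z]) (use lc in auto)
  from partial_eqI[OF this, of b] have "partial (coord b) b ?z = rho q + partial rho b ?z * (?z \<bullet> b)"
    using assms proj_basis orthonormal_B proj_chart[OF chart qU] lift_chart[OF chart qU] by simp
  then show ?thesis
    by (simp add: frame_def coord_smooth rho_smooth extend_eq coord_eq power3_eq_cube algebra_simps)
qed

end

context smooth_manifold
begin

lemma coordinate_ball_exists:
  obtains U \<phi> r R where "coordinate_ball E A B U \<phi> (\<phi> p) r R" "p \<in> U"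
proof -
  have "p \<in> (\<Union>(U, \<phi>)\<in>A. U)" using atlas by (simp add: smooth_atlas_def)
  then obtain U \<phi> where U: "(U, \<phi>) \<in> A" "p \<in> U" by blast
  have "\<phi> p \<in> proj -` (\<phi> ` U)" using U proj_chart by auto
  then obtain e where e: "e > 0" "ball (\<phi> p) e \<subseteq> proj -` (\<phi> ` U)"
    using open_vimage_proj[OF chart_image_openin[OF U(1)]] open_contains_ball by meson
  have "coordinate_ball E A B U \<phi> (\<phi> p) (e / 2) e"
    using U e by unfold_locales auto
  then show thesis using that U by blast
qed

section \<open>Vector fields and covectors\<close>

lemma tangent_eqI:
  "v \<in> T p \<Longrightarrow> w \<in> T p \<Longrightarrow> (\<And>f. f \<in> SF \<Longrightarrow> v f = w f) \<Longrightarrow> v = w"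
  by (rule ext) (metis tangent_nonsmooth)

lemma tangent_zero [simp]: "(\<lambda>f. 0) \<in> T p"
  by (simp add: tangent_space_def)

lemma tangent_space_add: "v \<in> T p \<Longrightarrow> w \<in> T p \<Longrightarrow> (\<lambda>f. v f + w f) \<in> T p"
  by (simp add: tangent_space_def algebra_simps)

lemma tangent_space_scale: "v \<in> T p \<Longrightarrow> (\<lambda>f. c * v f) \<in> T p"
  by (simp add: tangent_space_def algebra_simps)

lemma vector_field_tangent: "X \<in> VF \<Longrightarrow> X p \<in> T p"
  and vector_field_smooth: "X \<in> VF \<Longrightarrow> f \<in> SF \<Longrightarrow> (\<lambda>p. X p f) \<in> SF"
  unfolding vector_fields_def by auto

abbreviation fscale :: "('m \<Rightarrow> real) \<Rightarrow> ('m \<Rightarrow> 'm tvec) \<Rightarrow> 'm \<Rightarrow> 'm tvec" where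
  "fscale g X \<equiv> (\<lambda>p f. g p * X p f)"

lemma vector_field_zero [simp]: "(\<lambda>p f. 0) \<in> VF"
  by (simp add: vector_fields_def)

lemma vector_field_add: "X \<in> VF \<Longrightarrow> Y \<in> VF \<Longrightarrow> (\<lambda>p f. X p f + Y p f) \<in> VF"
  by (auto simp: vector_fields_def tangent_space_add)

lemma vector_field_scale: "g \<in> SF \<Longrightarrow> X \<in> VF \<Longrightarrow> fscale g X \<in> VF"
  by (auto simp: vector_fields_def tangent_space_scale)

lemma vector_field_sum:
  "(\<And>i. i \<in> I \<Longrightarrow> X i \<in> VF) \<Longrightarrow> (\<lambda>p f. \<Sum>i\<in>I. X i p f) \<in> VF"
  by (induction I rule: infinite_finite_induct) (auto simp: vector_field_add)

lemma lie_bracket_vector_field: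
  assumes X: "X \<in> VF" and Y: "Y \<in> VF"
  shows "lie_bracket X Y \<in> VF"
proof -
  note tX = vector_field_tangent[OF X] and tY = vector_field_tangent[OF Y]
  note sX = vector_field_smooth[OF X] and sY = vector_field_smooth[OF Y]
  note mX = tangent_mult[OF tX] and mY = tangent_mult[OF tY]
  note aX = tangent_add[OF tX] and aY = tangent_add[OF tY]
  have "lie_bracket X Y p \<in> T p" for p
    unfolding tangent_space_def lie_bracket_def mem_Collect_eq
  proof (intro conjI ballI allI impI)
    fix f g assume f: "f \<in> SF" and g: "g \<in> SF"
    show "X p (\<lambda>q. Y q (\<lambda>x. f x + g x)) - Y p (\<lambda>q. X q (\<lambda>x. f x + g x)) =
        X p (\<lambda>q. Y q f) - Y p (\<lambda>q. X q f) + (X p (\<lambda>q. Y q g) - Y p (\<lambda>q. X q g))"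
      using f g by (simp add: aX aY sX sY)
    show "X p (\<lambda>q. Y q (\<lambda>x. f x * g x)) - Y p (\<lambda>q. X q (\<lambda>x. f x * g x)) =
        f p * (X p (\<lambda>q. Y q g) - Y p (\<lambda>q. X q g)) + g p * (X p (\<lambda>q. Y q f) - Y p (\<lambda>q. X q f))"
      using f g by (simp add: aX aY mX mY sX sY smooth_mult algebra_simps)
  next
    fix c f assume f: "f \<in> SF"
    show "X p (\<lambda>q. Y q (\<lambda>x. c * f x)) - Y p (\<lambda>q. X q (\<lambda>x. c * f x)) =
        c * (X p (\<lambda>q. Y q f) - Y p (\<lambda>q. X q f))"
      using f by (simp add: tangent_scale[OF tX] tangent_scale[OF tY] sX sY algebra_simps)
  next
    fix f assume "f \<notin> SF"
    then show "X p (\<lambda>q. Y q f) - Y p (\<lambda>q. X q f) = 0"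
      by (simp add: tangent_nonsmooth[OF tX] tangent_nonsmooth[OF tY] tangent_const[OF tX] tangent_const[OF tY])
  qed
  moreover have "(\<lambda>p. lie_bracket X Y p f) \<in> SF" if "f \<in> SF" for f
    unfolding lie_bracket_def using that by (intro smooth_diff sX sY)
  ultimately show ?thesis by (simp add: vector_fields_def)
qed

lemma lie_bracket_swap: "lie_bracket X Y p f = - lie_bracket Y X p f"
  by (simp add: lie_bracket_def)

lemma lie_bracket_add_right:
  assumes X: "X \<in> VF" and Y: "Y \<in> VF" and Z: "Z \<in> VF"
  shows "lie_bracket X (\<lambda>q f. Y q f + Z q f) p = (\<lambda>f. lie_bracket X Y p f + lie_bracket X Z p f)"
proof (rule tangent_eqI[of _ p])
  show "lie_bracket X (\<lambda>q f. Y q f + Z q f) p \<in> T p"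
    by (intro vector_field_tangent lie_bracket_vector_field vector_field_add assms)
  show "(\<lambda>f. lie_bracket X Y p f + lie_bracket X Z p f) \<in> T p"
    by (intro tangent_space_add vector_field_tangent lie_bracket_vector_field assms)
  fix f assume "f \<in> SF"
  then show "lie_bracket X (\<lambda>q f. Y q f + Z q f) p f = lie_bracket X Y p f + lie_bracket X Z p f"
    using tangent_add[OF vector_field_tangent[OF X]] vector_field_smooth Y Z
    by (simp add: lie_bracket_def)
qed

lemma lie_bracket_scale_right:
  assumes X: "X \<in> VF" and Z: "Z \<in> VF" and g: "g \<in> SF"
  shows "lie_bracket X (fscale g Z) p = (\<lambda>f. g p * lie_bracket X Z p f + X p g * Z p f)"
proof (rule tangent_eqI[of _ p])
  show "lie_bracket X (fscale g Z) p \<in> T p"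
    by (intro vector_field_tangent lie_bracket_vector_field vector_field_scale assms)
  show "(\<lambda>f. g p * lie_bracket X Z p f + X p g * Z p f) \<in> T p"
    by (intro tangent_space_add tangent_space_scale vector_field_tangent lie_bracket_vector_field assms)
  fix f assume "f \<in> SF"
  then show "lie_bracket X (fscale g Z) p f = g p * lie_bracket X Z p f + X p g * Z p f"
    using tangent_mult[OF vector_field_tangent[OF X] g vector_field_smooth[OF Z]]
    by (simp add: lie_bracket_def algebra_simps)
qed

lemma lie_bracket_scale_left:
  assumes "X \<in> VF" "Z \<in> VF" "g \<in> SF"
  shows "lie_bracket (fscale g X) Z p = (\<lambda>f. g p * lie_bracket X Z p f - Z p g * X p f)"
  using lie_bracket_scale_right[OF assms(2,1,3), of p]
  by (simp add: fun_eq_iff lie_bracket_swap[of _ Z])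

section \<open>Tensoriality\<close>

text \<open>
  The only consequence of the existence of charts that tensoriality depends on; it holds for smooth and
  non-smooth \<open>f\<close> alike, so it is an identity of tangent vectors.
\<close>

lemma frame_exists:
  obtains \<rho> y W where "\<rho> \<in> SF" "\<rho> p \<noteq> 0"
    "\<And>b. y b \<in> SF" "\<And>b. W b \<in> VF"
    "\<And>q v f. v \<in> T q \<Longrightarrow>
      \<rho> q ^ 3 * v f = (\<Sum>b\<in>B. (\<rho> q * v (y b) - y b q * v \<rho>) * W b q f)"
proof -
  obtain U \<phi> r R where cb: "coordinate_ball E A B U \<phi> (\<phi> p) r R" and pU: "p \<in> U"
    by (rule coordinate_ball_exists)
  interpret coordinate_ball E A B U \<phi> "\<phi> p" r R by (rule cb)
  have "rho q ^ 3 * v f = (\<Sum>b\<in>B. (rho q * v (coord b) - coord b q * v rho) * frame b q f)"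
    if "v \<in> T q" for q v f
    using frame_expansion[OF that, of f] tangent_nonsmooth[OF that, of f]
    by (cases "f \<in> SF") (auto simp: frame_def)
  moreover have "rho p \<noteq> 0" using rho_neq_0_iff pU r_pos by simp
  ultimately show thesis
    using that rho_smooth coord_smooth frame_vector_field by blast
qed

lemma vector_field_through_exists:
  assumes v: "v \<in> T p"
  obtains X where "X \<in> VF" "X p = v"
proof -
  obtain \<rho> y W where \<rho>: "\<rho> \<in> SF" "\<rho> p \<noteq> 0" and y: "\<And>b. y b \<in> SF" and W: "\<And>b. W b \<in> VF"
    and eq: "\<And>q v f. v \<in> T q \<Longrightarrow>
      \<rho> q ^ 3 * v f = (\<Sum>b\<in>B. (\<rho> q * v (y b) - y b q * v \<rho>) * W b q f)"
    using frame_exists[of p] by blast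
  define X where "X = (\<lambda>q f. \<Sum>b\<in>B. (\<rho> p * v (y b) - y b p * v \<rho>) / \<rho> p ^ 3 * W b q f)"
  have "X \<in> VF" unfolding X_def
    using W by (intro vector_field_sum vector_field_scale smooth_const)
  moreover have "X p = v"
  proof
    fix f
    have "\<rho> p ^ 3 * X p f = \<rho> p ^ 3 * v f"
      unfolding eq[OF v] X_def using \<rho>(2) by (simp add: sum_distrib_left)
    then show "X p f = v f" using \<rho>(2) by simp
  qed
  ultimately show thesis using that by blast
qed

lemma field_through:
  assumes "v \<in> T p"
  shows "field_through A p v \<in> VF" "field_through A p v p = v"
proof -
  have "\<exists>X. X \<in> VF \<and> X p = v" using vector_field_through_exists[OF assms] by blast
  from someI_ex[OF this] show "field_through A p v \<in> VF" "field_through A p v p = v"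
    unfolding field_through_def by auto
qed

text \<open>
  Applying \<open>D\<close> to the expansion of \<open>\<rho>\<^sup>3 Z\<close> in the frame fields gives \<open>\<rho>(p)\<^sup>3 D Z\<close> as a linear combination of
  the values on the frame fields, with coefficients that depend on \<open>Z\<close> only through its value at \<open>p\<close>.
\<close>

lemma tensorial:
  fixes D :: "('m \<Rightarrow> 'm tvec) \<Rightarrow> real"
  assumes add: "\<And>Z Z'. Z \<in> VF \<Longrightarrow> Z' \<in> VF \<Longrightarrow> D (\<lambda>q f. Z q f + Z' q f) = D Z + D Z'"
    and scale: "\<And>g Z. g \<in> SF \<Longrightarrow> Z \<in> VF \<Longrightarrow> D (fscale g Z) = g p * D Z"
    and Z: "Z \<in> VF" and Z': "Z' \<in> VF" and eq: "Z p = Z' p"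
  shows "D Z = D Z'"
proof -
  obtain \<rho> y W where \<rho>: "\<rho> \<in> SF" "\<rho> p \<noteq> 0" and y: "\<And>b. y b \<in> SF" and W: "\<And>b. W b \<in> VF"
    and exp: "\<And>q v f. v \<in> T q \<Longrightarrow>
      \<rho> q ^ 3 * v f = (\<Sum>b\<in>B. (\<rho> q * v (y b) - y b q * v \<rho>) * W b q f)"
    using frame_exists[of p] by blast
  have D0: "D (\<lambda>q f. 0) = 0"
    using scale[OF smooth_const[of 0] vector_field_zero] by simp
  have D_sum: "D (\<lambda>q f. \<Sum>i\<in>I. X i q f) = (\<Sum>i\<in>I. D (X i))" if "\<And>i. X i \<in> VF" for X and I :: "'e set"
    using that by (induction I rule: infinite_finite_induct) (simp_all add: D0 add vector_field_sum)
  have "\<rho> p ^ 3 * D Z = (\<Sum>b\<in>B. (\<rho> p * Z p (y b) - y b p * Z p \<rho>) * D (W b))" if Z: "Z \<in> VF" for Z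
  proof -
    let ?c = "\<lambda>b q. \<rho> q * Z q (y b) - y b q * Z q \<rho>"
    have c: "?c b \<in> SF" for b
      by (intro smooth_diff smooth_mult \<rho> y vector_field_smooth[OF Z])
    have "\<rho> p ^ 3 * D Z = D (fscale (\<lambda>q. \<rho> q ^ 3) Z)"
      using scale[OF smooth_power[OF \<rho>(1)] Z] by simp
    also have "\<dots> = D (\<lambda>q f. \<Sum>b\<in>B. ?c b q * W b q f)"
      using exp[OF vector_field_tangent[OF Z]] by simp
    also have "\<dots> = (\<Sum>b\<in>B. ?c b p * D (W b))"
      using D_sum[of "\<lambda>b. fscale (?c b) (W b)"] scale[OF c W] vector_field_scale[OF c W] by simp
    finally show ?thesis .
  qed
  from this[OF Z] this[OF Z'] eq have "\<rho> p ^ 3 * D Z = \<rho> p ^ 3 * D Z'" by simp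
  then show ?thesis using \<rho>(2) by simp
qed

lemma one_form_add: "\<xi> \<in> one_forms A \<Longrightarrow> v \<in> T p \<Longrightarrow> w \<in> T p \<Longrightarrow> \<xi> p (\<lambda>f. v f + w f) = \<xi> p v + \<xi> p w"
  and one_form_scale: "\<xi> \<in> one_forms A \<Longrightarrow> v \<in> T p \<Longrightarrow> \<xi> p (\<lambda>f. c * v f) = c * \<xi> p v"
  and one_form_smooth: "\<xi> \<in> one_forms A \<Longrightarrow> X \<in> VF \<Longrightarrow> (\<lambda>p. \<xi> p (X p)) \<in> SF"
  unfolding one_forms_def cotangent_space_def by (auto simp: plus_fun_def)

lemma one_form_diff:
  assumes "\<xi> \<in> one_forms A" "v \<in> T p" "w \<in> T p"
  shows "\<xi> p (\<lambda>f. v f - w f) = \<xi> p v - \<xi> p w"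
  using one_form_add[OF assms(1,2) tangent_space_scale[OF assms(3), of "-1"]]
    one_form_scale[OF assms(1,3), of "-1"] by simp

lemma one_form_minus:
  "\<xi> \<in> one_forms A \<Longrightarrow> v \<in> T p \<Longrightarrow> \<xi> p (\<lambda>f. - v f) = - \<xi> p v"
  using one_form_scale[of \<xi> v p "-1"] by simp

text \<open>
  The terms with \<open>X(g)\<close> that \<open>X(\<eta>(gZ))\<close> and \<open>\<eta>([X,gZ])\<close> produce cancel, so the right-hand side is tensorial
  in \<open>Z\<close> and the extension of \<open>Z p\<close> chosen in the definition may be replaced by \<open>Z\<close>.
\<close>

lemma lie_derivative_eq:
  assumes X: "X \<in> VF" and \<eta>: "\<eta> \<in> one_forms A" and Z: "Z \<in> VF"
  shows "lie_derivative A X \<eta> p (Z p) = X p (\<lambda>q. \<eta> q (Z q)) - \<eta> p (lie_bracket X Z p)"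
proof -
  let ?D = "\<lambda>Z. X p (\<lambda>q. \<eta> q (Z q)) - \<eta> p (lie_bracket X Z p)"
  note tX = vector_field_tangent[OF X]
  note tL = vector_field_tangent[OF lie_bracket_vector_field]
  have "?D (field_through A p (Z p)) = ?D Z"
  proof (rule tensorial[of ?D p])
    show "?D (\<lambda>q f. Y q f + Z q f) = ?D Y + ?D Z" if Y: "Y \<in> VF" and Z: "Z \<in> VF" for Y Z
      using that by (simp add: lie_bracket_add_right X one_form_add[OF \<eta>] vector_field_tangent
          tangent_add[OF tX] one_form_smooth[OF \<eta>] lie_bracket_vector_field)
    show "?D (fscale g Z) = g p * ?D Z" if g: "g \<in> SF" and Z: "Z \<in> VF" for g Z
      using that by (simp add: lie_bracket_scale_right X one_form_add[OF \<eta>] one_form_scale[OF \<eta>]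
          tangent_space_scale vector_field_tangent tangent_mult[OF tX] one_form_smooth[OF \<eta>]
          lie_bracket_vector_field algebra_simps)
  qed (use Z field_through vector_field_tangent in auto)
  then show ?thesis
    using vector_field_tangent[OF Z] by (simp add: lie_derivative_def Let_def)
qed

text \<open>
  As for the Lie derivative, the formula is tensorial in its second field; by antisymmetry it is
  tensorial in the first one too.
\<close>

lemma exterior_derivative_eq:
  assumes \<xi>: "\<xi> \<in> one_forms A" and Y: "Y \<in> VF" and Z: "Z \<in> VF"
  shows "exterior_derivative A \<xi> p (Y p) (Z p) =
    Y p (\<lambda>q. \<xi> q (Z q)) - Z p (\<lambda>q. \<xi> q (Y q)) - \<xi> p (lie_bracket Y Z p)"
proof -
  let ?D = "\<lambda>Y Z. Y p (\<lambda>q. \<xi> q (Z q)) - Z p (\<lambda>q. \<xi> q (Y q)) - \<xi> p (lie_bracket Y Z p)"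
  have right: "?D Y Z = ?D Y Z'" if Y: "Y \<in> VF" and Z: "Z \<in> VF" "Z' \<in> VF" "Z p = Z' p" for Y Z Z'
  proof (rule tensorial[of "?D Y" p])
    note tY = vector_field_tangent[OF Y]
    show "?D Y (\<lambda>q f. X q f + Z q f) = ?D Y X + ?D Y Z" if "X \<in> VF" "Z \<in> VF" for X Z
      using that by (simp add: lie_bracket_add_right Y one_form_add[OF \<xi>] vector_field_tangent
          tangent_add[OF tY] one_form_smooth[OF \<xi>] lie_bracket_vector_field)
    show "?D Y (fscale g Z) = g p * ?D Y Z" if "g \<in> SF" "Z \<in> VF" for g Z
      using that by (simp add: lie_bracket_scale_right Y one_form_add[OF \<xi>] one_form_scale[OF \<xi>]
          tangent_space_scale vector_field_tangent tangent_mult[OF tY] one_form_smooth[OF \<xi>]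
          lie_bracket_vector_field algebra_simps)
  qed (use Z in auto)
  have swap: "?D Y Z = - ?D Z Y" if "Y \<in> VF" "Z \<in> VF" for Y Z
  proof -
    have "lie_bracket Y Z p = (\<lambda>f. - lie_bracket Z Y p f)" by (simp add: fun_eq_iff lie_bracket_def)
    then show ?thesis
      using one_form_minus[OF \<xi> vector_field_tangent[OF lie_bracket_vector_field]] that by simp
  qed
  let ?Y = "field_through A p (Y p)" and ?Z = "field_through A p (Z p)"
  have F: "?Y \<in> VF" "?Y p = Y p" "?Z \<in> VF" "?Z p = Z p"
    using field_through vector_field_tangent Y Z by auto
  have "?D ?Y ?Z = ?D ?Y Z" by (rule right) (use F Z in auto)
  also have "\<dots> = - ?D Z ?Y" by (rule swap) (use F Z in auto)
  also have "\<dots> = - ?D Z Y" using right[of Z ?Y Y] F Y Z by simp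
  also have "\<dots> = ?D Y Z" using swap[OF Y Z] by simp
  finally show ?thesis
    using vector_field_tangent[OF Z] vector_field_tangent[OF Y] by (simp add: exterior_derivative_def Let_def)
qed

end

section \<open>The torsion of the tensor on \<open>TM \<oplus> T\<^sup>*M\<close>\<close>

locale nijenhuis_manifold = smooth_manifold E A B
  for E :: "'e::euclidean_space set"
    and A :: "('m::{t2_space,second_countable_topology}, 'e) chart set"
    and B :: "'e set" +
  fixes N :: "'m \<Rightarrow> 'm tvec \<Rightarrow> 'm tvec"
  assumes morphism: "tangent_morphism A N"
    and nijenhuis_N: "nijenhuis VF lie_bracket N"
begin

abbreviation on_fields :: "('m \<Rightarrow> 'm tvec) \<Rightarrow> 'm \<Rightarrow> 'm tvec" where
  "on_fields X \<equiv> apply_section N X"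

abbreviation minus_dual :: "('m \<Rightarrow> 'm covec) \<Rightarrow> 'm \<Rightarrow> 'm covec" where
  "minus_dual \<xi> \<equiv> (\<lambda>p. - dual_morphism A N p (\<xi> p))"

lemma N_tangent: "v \<in> T p \<Longrightarrow> N p v \<in> T p"
  and N_add: "v \<in> T p \<Longrightarrow> w \<in> T p \<Longrightarrow> N p (\<lambda>f. v f + w f) = (\<lambda>f. N p v f + N p w f)"
  and N_scale: "v \<in> T p \<Longrightarrow> N p (\<lambda>f. c * v f) = (\<lambda>f. c * N p v f)"
  and N_field: "X \<in> VF \<Longrightarrow> on_fields X \<in> VF"
  using morphism unfolding tangent_morphism_def by (auto simp: plus_fun_def)

lemma N_diff: "v \<in> T p \<Longrightarrow> w \<in> T p \<Longrightarrow> N p (\<lambda>f. v f - w f) = (\<lambda>f. N p v f - N p w f)"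
  using N_add[OF _ tangent_space_scale, of v p w "-1"] N_scale[of w p "-1"] by simp

lemma N_zero: "N p (\<lambda>f. 0) = (\<lambda>f. 0)"
  using N_scale[OF tangent_zero, of p 0] by simp

text \<open>
  The vanishing torsion of \<open>N\<close>, with the brackets separated so that a 1-form can be applied to each.
\<close>

lemma lie_bracket_on_fields:
  assumes "X \<in> VF" "Y \<in> VF"
  shows "lie_bracket (on_fields X) (on_fields Y) p =
    (\<lambda>f. N p (lie_bracket (on_fields X) Y p) f + N p (lie_bracket X (on_fields Y) p) f
      - N p (N p (lie_bracket X Y p)) f)"
proof -
  note t = vector_field_tangent lie_bracket_vector_field N_field assms N_tangent
  have "nijenhuis_torsion lie_bracket N X Y p = 0"
    using nijenhuis_N assms by (simp add: nijenhuis_def)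
  then have "lie_bracket (on_fields X) (on_fields Y) p =
      N p (\<lambda>f. (lie_bracket (on_fields X) Y p f + lie_bracket X (on_fields Y) p f) - N p (lie_bracket X Y p) f)"
    by (simp add: nijenhuis_torsion_def contracted_def apply_section_def[of _ "_ - _"]
        fun_diff_def plus_fun_def zero_fun_def fun_eq_iff apply_section_def)
  also have "\<dots> = (\<lambda>f. N p (\<lambda>f. lie_bracket (on_fields X) Y p f + lie_bracket X (on_fields Y) p f) f
      - N p (N p (lie_bracket X Y p)) f)"
    by (intro N_diff tangent_space_add t)
  also have "N p (\<lambda>f. lie_bracket (on_fields X) Y p f + lie_bracket X (on_fields Y) p f) =
      (\<lambda>f. N p (lie_bracket (on_fields X) Y p) f + N p (lie_bracket X (on_fields Y) p) f)"
    by (intro N_add t)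
  finally show ?thesis .
qed

lemma minus_dual_eval: "v \<in> T p \<Longrightarrow> minus_dual \<xi> p v = - \<xi> p (N p v)"
  by (simp add: dual_morphism_def)

lemma minus_dual_one_form:
  assumes \<xi>: "\<xi> \<in> one_forms A"
  shows "minus_dual \<xi> \<in> one_forms A"
proof -
  have "minus_dual \<xi> p \<in> cotangent_space A p" for p
    unfolding cotangent_space_def mem_Collect_eq
  proof (intro conjI ballI allI impI)
    fix v w assume "v \<in> T p" "w \<in> T p"
    then show "minus_dual \<xi> p (v + w) = minus_dual \<xi> p v + minus_dual \<xi> p w"
      by (simp add: plus_fun_def minus_dual_eval tangent_space_add N_add N_tangent one_form_add[OF \<xi>] del: uminus_apply)
  next
    fix c v assume "v \<in> T p"
    then show "minus_dual \<xi> p (\<lambda>f. c * v f) = c * minus_dual \<xi> p v"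
      by (simp add: minus_dual_eval tangent_space_scale N_scale N_tangent one_form_scale[OF \<xi>] del: uminus_apply)
  qed (simp add: dual_morphism_def)
  moreover have "(\<lambda>p. minus_dual \<xi> p (X p)) \<in> SF" if X: "X \<in> VF" for X
    using smooth_uminus[OF one_form_smooth[OF \<xi> N_field[OF X]]] vector_field_tangent[OF X]
    by (simp add: minus_dual_eval apply_section_def del: uminus_apply)
  ultimately show ?thesis by (simp add: one_forms_def)
qed

lemma big_section_apply:
  assumes "s \<in> big_sections A"
  shows "apply_section (big_morphism A N) s \<in> big_sections A"
    and "fst \<circ> apply_section (big_morphism A N) s = on_fields (fst \<circ> s)"
    and "snd \<circ> apply_section (big_morphism A N) s = minus_dual (snd \<circ> s)"
proof -
  show 1: "fst \<circ> apply_section (big_morphism A N) s = on_fields (fst \<circ> s)"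
    and 2: "snd \<circ> apply_section (big_morphism A N) s = minus_dual (snd \<circ> s)"
    by (simp_all add: fun_eq_iff apply_section_def big_morphism_def split_beta)
  show "apply_section (big_morphism A N) s \<in> big_sections A"
    using assms N_field minus_dual_one_form unfolding big_sections_def mem_Collect_eq 1 2 by blast
qed

lemma courant_fst: "fst (courant_bracket A s t p) = lie_bracket (fst \<circ> s) (fst \<circ> t) p"
  by (simp add: courant_bracket_def Let_def)

text \<open>
  Cartan's formulas for actual vector fields, in place of the extensions chosen in the definitions.
\<close>

lemma courant_snd:
  assumes "s \<in> big_sections A" "t \<in> big_sections A" "Z \<in> VF"
    and "X = fst \<circ> s" "\<xi> = snd \<circ> s" "Y = fst \<circ> t" "\<eta> = snd \<circ> t"
  shows "snd (courant_bracket A s t p) (Z p) =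
    X p (\<lambda>q. \<eta> q (Z q)) - \<eta> p (lie_bracket X Z p)
    - (Y p (\<lambda>q. \<xi> q (Z q)) - Z p (\<lambda>q. \<xi> q (Y q)) - \<xi> p (lie_bracket Y Z p))"
  using assms lie_derivative_eq[of X \<eta> Z p] exterior_derivative_eq[of \<xi> Y Z p]
  by (simp add: courant_bracket_def Let_def interior_product_def big_sections_def)

lemma courant_snd_off_tangent: "w \<notin> T p \<Longrightarrow> snd (courant_bracket A s t p) w = 0"
  by (simp add: courant_bracket_def Let_def interior_product_def lie_derivative_def exterior_derivative_def)

lemma torsion_fst:
  assumes "s \<in> big_sections A" "t \<in> big_sections A"
  shows "fst (nijenhuis_torsion (courant_bracket A) (big_morphism A N) s t p) = 0"
proof -
  have "fst (nijenhuis_torsion (courant_bracket A) (big_morphism A N) s t p) =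
      nijenhuis_torsion lie_bracket N (fst \<circ> s) (fst \<circ> t) p"
    by (simp add: nijenhuis_torsion_def contracted_def apply_section_def big_morphism_def split_beta
        courant_fst[unfolded o_def] o_def)
  also have "\<dots> = 0"
    using nijenhuis_N assms by (simp add: nijenhuis_def big_sections_def)
  finally show ?thesis .
qed

lemma torsion_snd_off_tangent:
  assumes "w \<notin> T p"
  shows "snd (nijenhuis_torsion (courant_bracket A) (big_morphism A N) s t p) w = 0"
  using assms courant_snd_off_tangent[OF assms]
  by (simp add: nijenhuis_torsion_def apply_section_def big_morphism_def split_beta dual_morphism_def)

text \<open>
  The dual map acts with a minus sign on covectors, hence each application of the big tensor outside a
  bracket amounts to evaluating at \<open>N w\<close> and changing the sign.
\<close>

lemma torsion_snd_expand:
  assumes "w \<in> T p"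
  shows "snd (nijenhuis_torsion (courant_bracket A) (big_morphism A N) s t p) w =
    snd (courant_bracket A (apply_section (big_morphism A N) s) (apply_section (big_morphism A N) t) p) w
    + snd (courant_bracket A (apply_section (big_morphism A N) s) t p) (N p w)
    + snd (courant_bracket A s (apply_section (big_morphism A N) t) p) (N p w)
    + snd (courant_bracket A s t p) (N p (N p w))"
  using assms N_tangent[OF assms]
  by (simp add: nijenhuis_torsion_def contracted_def apply_section_def[of _ "courant_bracket _ _ _"]
      apply_section_def[of _ "_ - _"] big_morphism_def split_beta dual_morphism_def)

text \<open>
  All but two of the derivatives of pairings cancel, for instance those along \<open>X\<close>, \<open>Y\<close>, \<open>N X\<close> and \<open>N Y\<close>, and
  the brackets \<open>[N X, N Z]\<close> and \<open>[N Y, N Z]\<close> are removed by the vanishing torsion of \<open>N\<close>. What remains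
  involves \<open>N\<close> only through its square.
\<close>

lemma torsion_snd:
  assumes s: "s \<in> big_sections A" and t: "t \<in> big_sections A" and Z: "Z \<in> VF"
    and X: "X = fst \<circ> s" and \<xi>: "\<xi> = snd \<circ> s" and Y: "Y = fst \<circ> t" and \<eta>: "\<eta> = snd \<circ> t"
  shows "snd (nijenhuis_torsion (courant_bracket A) (big_morphism A N) s t p) (Z p) =
    \<eta> p (N p (N p (lie_bracket X Z p))) - \<eta> p (lie_bracket X (on_fields (on_fields Z)) p)
    + N p (N p (Z p)) (\<lambda>q. \<xi> q (Y q)) - Z p (\<lambda>q. \<xi> q (N q (N q (Y q))))
    + \<xi> p (lie_bracket Y (on_fields (on_fields Z)) p) - \<xi> p (N p (N p (lie_bracket Y Z p)))"
proof -
  have VX: "X \<in> VF" and VY: "Y \<in> VF" and O\<xi>: "\<xi> \<in> one_forms A" and O\<eta>: "\<eta> \<in> one_forms A"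
    using s t X Y \<xi> \<eta> by (auto simp: big_sections_def)
  note VN = N_field[OF VX] N_field[OF VY] N_field[OF Z] N_field[OF N_field[OF Z]]
  note tan = vector_field_tangent N_tangent lie_bracket_vector_field VX VY Z VN
  let ?M = "apply_section (big_morphism A N)"
  note Ms = big_section_apply[OF s] and Mt = big_section_apply[OF t]
  have neg: "V p (\<lambda>q. - \<zeta> q (N q (W q))) = - V p (\<lambda>q. \<zeta> q (N q (W q)))"
    if "V \<in> VF" "W \<in> VF" "\<zeta> \<in> one_forms A" for V W \<zeta>
    using tangent_scale[OF vector_field_tangent[OF that(1)] one_form_smooth[OF that(3) N_field[OF that(2)]], of p "-1"]
    by (simp add: apply_section_def)
  have N2: "\<zeta> p (lie_bracket (on_fields V) (on_fields Z) p) =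
      \<zeta> p (N p (lie_bracket (on_fields V) Z p)) + \<zeta> p (N p (lie_bracket V (on_fields Z) p))
      - \<zeta> p (N p (N p (lie_bracket V Z p)))"
    if V: "V \<in> VF" and \<zeta>: "\<zeta> \<in> one_forms A" for V \<zeta>
    using V N_field[OF V] by (simp add: lie_bracket_on_fields Z one_form_diff[OF \<zeta>] one_form_add[OF \<zeta>] tan tangent_space_add)
  have app: "on_fields V q = N q (V q)" for V q by (simp add: apply_section_def)
  note negs = neg[OF VN(1) Z O\<eta>, unfolded app] neg[OF VX VN(3) O\<eta>, unfolded app]
    neg[OF VN(2) Z O\<xi>, unfolded app] neg[OF Z VN(2) O\<xi>, unfolded app]
    neg[OF VY VN(3) O\<xi>, unfolded app] neg[OF VN(3) VY O\<xi>, unfolded app]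
  \<comment> \<open>The four brackets of the expansion, evaluated at \<open>Z\<close>, \<open>N Z\<close>, \<open>N Z\<close> and \<open>N\<^sup>2 Z\<close>.\<close>
  note C1 = courant_snd[OF Ms(1) Mt(1) Z refl refl refl refl, of p, unfolded Ms(2,3) Mt(2,3) X[symmetric] Y[symmetric] \<xi>[symmetric] \<eta>[symmetric]]
  note C2 = courant_snd[OF Ms(1) t VN(3) refl refl refl refl, of p, unfolded Ms(2,3) X[symmetric] Y[symmetric] \<xi>[symmetric] \<eta>[symmetric]]
  note C3 = courant_snd[OF s Mt(1) VN(3) refl refl refl refl, of p, unfolded Mt(2,3) X[symmetric] Y[symmetric] \<xi>[symmetric] \<eta>[symmetric]]
  note C4 = courant_snd[OF s t VN(4) X \<xi> Y \<eta>, of p]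
  show ?thesis
    unfolding torsion_snd_expand[OF vector_field_tangent[OF Z]]
    using C1 C2 C3 C4
    by (simp add: negs minus_dual_eval tan N2[OF VX O\<eta>] N2[OF VY O\<xi>] app del: uminus_apply)
qed

end

context nijenhuis_manifold
begin

section \<open>The square is a constant multiple of the identity\<close>

lemma nijenhuis_if_square_scalar:
  assumes c: "\<And>p v. v \<in> T p \<Longrightarrow> N p (N p v) = (\<lambda>f. c * v f)"
  shows "nijenhuis (big_sections A) (courant_bracket A) (big_morphism A N)"
  unfolding nijenhuis_def
proof (intro ballI ext prod_eqI)
  fix s t p assume s: "s \<in> big_sections A" and t: "t \<in> big_sections A"
  let ?T = "nijenhuis_torsion (courant_bracket A) (big_morphism A N) s t p"
  show "fst ?T f = fst (0 p) f" for f using torsion_fst[OF s t] by simp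
  fix w
  show "snd ?T w = snd (0 p) w"
  proof (cases "w \<in> T p")
    case True
    define Z where "Z = field_through A p w"
    have Z: "Z \<in> VF" "Z p = w" using field_through[OF True] by (auto simp: Z_def)
    define X \<xi> Y \<eta> where sect: "X = fst \<circ> s" "\<xi> = snd \<circ> s" "Y = fst \<circ> t" "\<eta> = snd \<circ> t"
    have V: "X \<in> VF" "Y \<in> VF" and \<xi>: "\<xi> \<in> one_forms A" and \<eta>: "\<eta> \<in> one_forms A"
      using s t by (auto simp: big_sections_def sect)
    have NNZ: "on_fields (on_fields Z) = fscale (\<lambda>_. c) Z"
      using c[OF vector_field_tangent[OF Z(1)]] by (simp add: apply_section_def fun_eq_iff)
    have NNY: "\<xi> q (N q (N q (Y q))) = c * \<xi> q (Y q)" for q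
      using V by (simp add: c vector_field_tangent one_form_scale[OF \<xi>])
    have "snd ?T (Z p) = 0"
      unfolding torsion_snd[OF s t Z(1) sect] NNZ NNY
      using V Z(1) by (simp add: c vector_field_tangent lie_bracket_vector_field lie_bracket_scale_right
          tangent_const[OF vector_field_tangent] tangent_scale[OF vector_field_tangent[OF Z(1)] one_form_smooth[OF \<xi>]]
          one_form_scale[OF \<xi>] one_form_scale[OF \<eta>])
    then show ?thesis using Z(2) by simp
  next
    case False
    then show ?thesis using torsion_snd_off_tangent[OF False] by simp
  qed
qed

definition differential :: "('m \<Rightarrow> real) \<Rightarrow> 'm \<Rightarrow> 'm covec" where
  "differential f p v = (if v \<in> T p then v f else 0)"

lemma differential_one_form: "f \<in> SF \<Longrightarrow> differential f \<in> one_forms A"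
  by (simp add: one_forms_def cotangent_space_def differential_def plus_fun_def
      tangent_space_add tangent_space_scale vector_field_tangent vector_field_smooth)

end

locale big_nijenhuis = nijenhuis_manifold E A B N
  for E :: "'e::euclidean_space set"
    and A :: "('m::{t2_space,second_countable_topology}, 'e) chart set"
    and B :: "'e set" and N +
  assumes big: "nijenhuis (big_sections A) (courant_bracket A) (big_morphism A N)"
begin

text \<open>
  The torsion of \<open>X\<close> and \<open>df\<close>, evaluated at \<open>Z\<close>, is the difference of the two sides applied to \<open>f\<close>. The
  differentials suffice as test forms, a tangent vector being a function of smooth functions.
\<close>

lemma square_commutes:
  assumes X: "X \<in> VF" and Z: "Z \<in> VF"
  shows "lie_bracket X (on_fields (on_fields Z)) p = N p (N p (lie_bracket X Z p))"
proof (rule tangent_eqI)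
  show "lie_bracket X (on_fields (on_fields Z)) p \<in> T p" "N p (N p (lie_bracket X Z p)) \<in> T p"
    using X Z by (auto intro!: vector_field_tangent lie_bracket_vector_field N_field N_tangent)
  then show "lie_bracket X (on_fields (on_fields Z)) p f = N p (N p (lie_bracket X Z p)) f" if f: "f \<in> SF" for f
  proof -
    assume tan: "lie_bracket X (on_fields (on_fields Z)) p \<in> T p" "N p (N p (lie_bracket X Z p)) \<in> T p"
    let ?s = "\<lambda>p. (X p, \<lambda>v. 0)" and ?t = "\<lambda>p. (\<lambda>f. 0, differential f p)"
    have s: "?s \<in> big_sections A" and t: "?t \<in> big_sections A"
      using X differential_one_form[OF f]
      by (simp_all add: big_sections_def o_def one_forms_def cotangent_space_def)
    have "nijenhuis_torsion (courant_bracket A) (big_morphism A N) ?s ?t p = 0"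
      using big s t unfolding nijenhuis_def by simp
    then show ?thesis
      using torsion_snd[OF s t Z refl refl refl refl, of p] tan
        tangent_const[OF vector_field_tangent[OF Z]] tangent_const[OF N_tangent[OF N_tangent[OF vector_field_tangent[OF Z]]]]
      by (simp add: o_def differential_def)
  qed
qed

text \<open>
  In the commutation relation for \<open>gX\<close>, the terms that contain no derivative of \<open>g\<close> cancel by the relation
  for \<open>X\<close>; the others are the two sides. Fixing \<open>v\<close> and
  \<open>g\<close> with \<open>v g \<noteq> 0\<close>, this displays the square of \<open>N\<close> as a multiple of the identity without a choice of
  basis.
\<close>

lemma square_parallel:
  assumes v: "v \<in> T p" and w: "w \<in> T p" and g: "g \<in> SF"
  shows "N p (N p v) g * w f = v g * N p (N p w) f"
proof -
  obtain Z where Z: "Z \<in> VF" "Z p = v" by (rule vector_field_through_exists[OF v])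
  obtain X where X: "X \<in> VF" "X p = w" by (rule vector_field_through_exists[OF w])
  have L: "lie_bracket X Z p \<in> T p" using X Z by (intro vector_field_tangent lie_bracket_vector_field)
  have "N p (N p (lie_bracket (fscale g X) Z p)) =
      (\<lambda>f. g p * N p (N p (lie_bracket X Z p)) f - v g * N p (N p w) f)"
    using w by (simp add: lie_bracket_scale_left X Z g N_diff N_scale N_tangent tangent_space_scale L)
  moreover have "lie_bracket (fscale g X) (on_fields (on_fields Z)) p =
      (\<lambda>f. g p * N p (N p (lie_bracket X Z p)) f - N p (N p v) g * w f)"
    by (simp add: lie_bracket_scale_left X Z g N_field square_commutes) (simp add: apply_section_def Z)
  ultimately have "(\<lambda>f. g p * N p (N p (lie_bracket X Z p)) f - v g * N p (N p w) f) =
      (\<lambda>f. g p * N p (N p (lie_bracket X Z p)) f - N p (N p v) g * w f)"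
    using square_commutes[OF vector_field_scale[OF g X(1)] Z(1), of p] by simp
  from fun_cong[OF this, of f] show ?thesis by simp
qed

lemma square_scalar_at: "\<exists>l. \<forall>w\<in>T p. N p (N p w) = (\<lambda>f. l * w f)"
proof (cases "\<exists>v\<in>T p. \<exists>g\<in>SF. v g \<noteq> 0")
  case True
  then obtain v g where v: "v \<in> T p" "g \<in> SF" "v g \<noteq> 0" by blast
  have "N p (N p w) f = N p (N p v) g / v g * w f" if "w \<in> T p" for w f
    using square_parallel[OF v(1) that v(2), of f] v(3) by (simp add: field_simps)
  then show ?thesis by blast
next
  case False
  then have "w = (\<lambda>f. 0)" if "w \<in> T p" for w
    using that by (intro tangent_eqI[of w p]) auto
  then show ?thesis using N_zero by (metis mult_zero_right)
qed

text \<open>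
  The choice matters only where the tangent space is zero, that is, on manifolds of dimension 0.
\<close>

definition eigenvalue :: "'m \<Rightarrow> real" where
  "eigenvalue p = (SOME l. \<forall>w\<in>T p. N p (N p w) = (\<lambda>f. l * w f))"

lemma square_eq_eigenvalue: "w \<in> T p \<Longrightarrow> N p (N p w) = (\<lambda>f. eigenvalue p * w f)"
  using someI_ex[OF square_scalar_at[of p]] unfolding eigenvalue_def by blast

text \<open>
  The eigenvalue is the quotient of the global smooth functions \<open>h\<close> and \<open>P = \<rho>\<^sup>3\<close>, which is how a function
  obtained by choice is seen to be differentiable. Inserting \<open>P Z\<close> into \<open>square_commutes\<close>, for a field
  \<open>Z\<close> without zeros on the ball, gives \<open>X(h) = \<lambda> X(P)\<close>, so the derivative of \<open>h / P\<close> is zero in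
  the directions of \<open>E\<close>, and \<open>h / P\<close> is constant along segments.
\<close>

lemma eigenvalue_constant_on_ball:
  assumes cb: "coordinate_ball E A B U \<phi> a r R" and b: "b \<in> B"
    and q: "q1 \<in> U" "\<phi> q1 \<in> ball a r" "q2 \<in> U" "\<phi> q2 \<in> ball a r"
  shows "eigenvalue q1 = eigenvalue q2"
proof -
  interpret coordinate_ball E A B U \<phi> a r R by (rule cb)
  let ?Z = "frame b"
  define P where "P = (\<lambda>q. rho q ^ 3)"
  define h where "h = (\<lambda>q. eigenvalue q * P q)"
  have P: "P \<in> SF" unfolding P_def by (intro smooth_power rho_smooth)
  have Z: "?Z \<in> VF" by (rule frame_vector_field)
  have NNZ: "on_fields (on_fields ?Z) q f = eigenvalue q * ?Z q f" for q f
    using square_eq_eigenvalue[OF vector_field_tangent[OF Z]] by (simp add: apply_section_def)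
  have h: "h \<in> SF"
  proof -
    have JZ: "(\<lambda>q. on_fields (on_fields ?Z) q f) \<in> SF" if "f \<in> SF" for f
      using that by (rule vector_field_smooth[OF N_field[OF N_field[OF Z]]])
    have "(\<lambda>q. rho q * on_fields (on_fields ?Z) q (coord b) - coord b q * on_fields (on_fields ?Z) q rho) \<in> SF"
      by (intro smooth_diff smooth_mult JZ rho_smooth coord_smooth)
    moreover have "rho q * on_fields (on_fields ?Z) q (coord b) - coord b q * on_fields (on_fields ?Z) q rho = h q" for q
      by (simp add: h_def P_def NNZ frame_dual[OF b, of q, symmetric] algebra_simps)
    ultimately show ?thesis by simp
  qed
  have NNPZ: "on_fields (on_fields (fscale P ?Z)) = fscale h ?Z"
    using square_eq_eigenvalue[OF vector_field_tangent[OF vector_field_scale[OF P Z]]]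
    by (simp add: apply_section_def fun_eq_iff h_def)
  \<comment> \<open>Comparison of the terms with \<open>X(h)\<close> and \<open>X(P)\<close> in the two sides of \<open>[X, hZ] = \<lambda> [X, PZ]\<close>.\<close>
  have deriv: "X q h = eigenvalue q * X q P" if X: "X \<in> VF" and rho: "rho q \<noteq> 0" for X q
  proof -
    have L: "lie_bracket X (fscale P ?Z) q \<in> T q"
      by (intro vector_field_tangent lie_bracket_vector_field X vector_field_scale P Z)
    have "lie_bracket X (fscale h ?Z) q = (\<lambda>f. eigenvalue q * lie_bracket X (fscale P ?Z) q f)"
      using square_commutes[OF X vector_field_scale[OF P Z], of q] square_eq_eigenvalue[OF L] by (simp add: NNPZ)
    then have eq: "X q h * ?Z q f = eigenvalue q * X q P * ?Z q f" for f
      unfolding lie_bracket_scale_right[OF X Z P] lie_bracket_scale_right[OF X Z h]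
      by (auto simp: fun_eq_iff h_def algebra_simps)
    have "?Z q (coord b) \<noteq> 0 \<or> ?Z q rho \<noteq> 0"
      using frame_dual[OF b, of q] rho by auto
    then show ?thesis using eq by auto
  qed
  let ?u = "\<phi> q2 - \<phi> q1"
  let ?z = "\<lambda>t. \<phi> q1 + t *\<^sub>R ?u"
  have "?u \<in> E" using chart_in_E[OF chart] q subspace_diff[OF subspace_E] by blast
  then have u: "?u = (\<Sum>c\<in>B. (?u \<bullet> c) *\<^sub>R c)" using proj_eq by (simp add: proj_def)
  have quotient: "((\<lambda>t. lift U \<phi> h (?z t) / lift U \<phi> P (?z t)) has_field_derivative 0) (at t within {0..1})
      \<and> lift U \<phi> h (?z t) / lift U \<phi> P (?z t) = eigenvalue (inv_into U \<phi> (?z t))"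
    if t: "t \<in> {0..1}" for t
  proof -
    have zb: "?z t \<in> ball a r" by (rule segment_in_ball[OF q(2,4) t])
    have "?z t \<in> E"
      using chart_in_E[OF chart q(1)] \<open>?u \<in> E\<close> subspace_add[OF subspace_E] subspace_scale[OF subspace_E] by blast
    then have pz: "proj (?z t) = ?z t" by (rule proj_eq)
    have zd: "?z t \<in> proj -` (\<phi> ` U)"
      using zb subset_ball[OF less_imp_le[OF r_less], of a] ball_subset by blast
    then have zU: "?z t \<in> \<phi> ` U" using pz by auto
    define q where "q = inv_into U \<phi> (?z t)"
    have qU: "q \<in> U" "\<phi> q = ?z t" using zU by (simp_all add: q_def inv_into_into f_inv_into_f)
    have rho: "rho q \<noteq> 0" using rho_neq_0_iff qU zb by simp
    have Lh: "lift U \<phi> h (?z t) = eigenvalue q * lift U \<phi> P (?z t)" and LP: "lift U \<phi> P (?z t) \<noteq> 0"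
      using rho by (simp_all add: lift_def pz h_def P_def flip: q_def)
    have pd_basis: "partial h c (?z t) = eigenvalue q * partial P c (?z t)" for c
      using deriv[OF frame_vector_field rho, of c] rho by (simp add: frame_def h P extend_eq qU)
    have pd_u: "partial f ?u (?z t) = (\<Sum>c\<in>B. (?u \<bullet> c) * partial f c (?z t))" if "f \<in> SF" for f
    proof -
      interpret l: linear "\<lambda>b. partial f b (?z t)"
        using lift_has_derivative[OF that zd] has_derivative_linear by blast
      show ?thesis
        using arg_cong[OF u, of "\<lambda>b. partial f b (?z t)"] by (simp only: l.sum l.scale real_scaleR_def)
    qed
    have partial: "partial h ?u (?z t) = eigenvalue q * partial P ?u (?z t)"
      by (simp add: pd_u h P pd_basis sum_distrib_left mult_ac)
    have along: "((\<lambda>t. lift U \<phi> f (?z t)) has_field_derivative partial f ?u (?z t)) (at t within {0..1})" if "f \<in> SF" for f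
    proof -
      have "((\<lambda>t. ?z t) has_derivative (\<lambda>s. s *\<^sub>R ?u)) (at t within {0..1})"
        by (auto intro!: derivative_eq_intros)
      from has_derivative_compose[OF this lift_has_derivative[OF that zd]]
      show ?thesis
        using linear_scale[OF has_derivative_linear[OF lift_has_derivative[OF that zd]]]
        by (simp add: has_field_derivative_def mult_commute_abs)
    qed
    have "((\<lambda>t. lift U \<phi> h (?z t) / lift U \<phi> P (?z t)) has_field_derivative 0) (at t within {0..1})"
      using DERIV_divide[OF along[OF h] along[OF P] LP] by (simp add: partial Lh)
    with Lh LP show ?thesis by (simp add: q_def)
  qed
  from this[THEN conjunct1] have "\<exists>c. \<forall>t\<in>{0..1}. lift U \<phi> h (?z t) / lift U \<phi> P (?z t) = c"
    by (intro has_field_derivative_zero_constant convex_real_interval)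
  then obtain c where c: "\<And>t. t \<in> {0..1} \<Longrightarrow> eigenvalue (inv_into U \<phi> (?z t)) = c"
    using quotient[THEN conjunct2] by metis
  from c[of 0] c[of 1] show ?thesis using chart_inv[OF chart] q by simp
qed

text \<open>
  If the basis is empty, the manifold has dimension 0 and every tangent vector is zero. The frame field
  needed to read off the eigenvalue exists as soon as there is a basis vector.
\<close>

lemma square_scalar:
  assumes conn: "connected (UNIV :: 'm set)"
  shows "\<exists>c. \<forall>p. \<forall>v\<in>T p. N p (N p v) = (\<lambda>f. c * v f)"
proof (cases "B = {}")
  case True
  have "v = (\<lambda>f. 0)" if v: "v \<in> T p" for v p
  proof -
    obtain \<rho> y W where "\<rho> \<in> SF" and \<rho>: "\<rho> p \<noteq> 0" and "\<And>b. y b \<in> SF" "\<And>b. W b \<in> VF"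
      and expansion: "\<And>q v f. v \<in> T q \<Longrightarrow>
        \<rho> q ^ 3 * v f = (\<Sum>b\<in>B. (\<rho> q * v (y b) - y b q * v \<rho>) * W b q f)"
      using frame_exists[of p] by blast
    from \<rho> expansion[OF v] True show ?thesis by auto
  qed
  then show ?thesis using N_zero by (metis mult_zero_right)
next
  case False
  then obtain b where b: "b \<in> B" by blast
  have "eigenvalue constant_on UNIV"
  proof (rule locally_constant_imp_constant[OF conn])
    fix p :: 'm
    obtain U \<phi> r R where cb: "coordinate_ball E A B U \<phi> (\<phi> p) r R" and pU: "p \<in> U"
      by (rule coordinate_ball_exists)
    interpret coordinate_ball E A B U \<phi> "\<phi> p" r R by (rule cb)
    show "\<exists>S. openin (top_of_set UNIV) S \<and> p \<in> S \<and> (\<forall>x\<in>S. eigenvalue x = eigenvalue p)"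
    proof (intro exI conjI ballI)
      show "openin (top_of_set UNIV) {q \<in> U. \<phi> q \<in> ball (\<phi> p) r}"
        using open_ball_domain[of r] by simp
      show "p \<in> {q \<in> U. \<phi> q \<in> ball (\<phi> p) r}" using pU r_pos by simp
      show "eigenvalue x = eigenvalue p" if "x \<in> {q \<in> U. \<phi> q \<in> ball (\<phi> p) r}" for x
        using that pU r_pos by (intro eigenvalue_constant_on_ball[OF cb b]) auto
    qed
  qed
  then obtain c where "\<And>p. eigenvalue p = c" by (auto simp: constant_on_def)
  then show ?thesis using square_eq_eigenvalue by auto
qed

end

lemma smooth_manifold_exists_basis:
  assumes "smooth_atlas E A"
  obtains B where "smooth_manifold E A B"
proof -
  obtain B where B: "pairwise orthogonal B" "\<And>x. x \<in> B \<Longrightarrow> norm x = 1" "independent B" "span B = E"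
    using assms orthonormal_basis_subspace[of E] unfolding smooth_atlas_def by metis
  have "smooth_manifold E A B"
  proof
    show "finite B" using B(3) independent_imp_finite by blast
    show "b \<bullet> c = (if b = c then 1 else 0)" if "b \<in> B" "c \<in> B" for b c
      using that B(1,2) norm_eq_1 by (auto simp: pairwise_def orthogonal_def)
  qed (use assms B in auto)
  then show thesis by (rule that)
qed

theorem theorem3:
  fixes E :: "'e::euclidean_space set"
    and A :: "('m::{t2_space,second_countable_topology}, 'e) chart set"
    and N\<^sub>0 :: "'m \<Rightarrow> 'm tvec \<Rightarrow> 'm tvec"
  assumes "smooth_atlas E A"
    and "connected (UNIV :: 'm set)"
    and "tangent_morphism A N\<^sub>0"
    and "nijenhuis (vector_fields A) lie_bracket N\<^sub>0"
  shows "nijenhuis (big_sections A) (courant_bracket A) (big_morphism A N\<^sub>0) \<longleftrightarrow>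
         (\<exists>c::real. \<forall>p. \<forall>v\<in>tangent_space A p. N\<^sub>0 p (N\<^sub>0 p v) = (\<lambda>f. c * v f))"
proof -
  obtain B where B: "smooth_manifold E A B" by (rule smooth_manifold_exists_basis[OF assms(1)])
  interpret nijenhuis_manifold E A B N\<^sub>0
    using B assms(3,4) by (simp add: nijenhuis_manifold_def nijenhuis_manifold_axioms_def)
  show ?thesis
  proof
    assume "nijenhuis (big_sections A) (courant_bracket A) (big_morphism A N\<^sub>0)"
    then interpret big_nijenhuis E A B N\<^sub>0 by unfold_locales
    show "\<exists>c. \<forall>p. \<forall>v\<in>tangent_space A p. N\<^sub>0 p (N\<^sub>0 p v) = (\<lambda>f. c * v f)"
      by (rule square_scalar[OF assms(2)])
  next
    assume "\<exists>c. \<forall>p. \<forall>v\<in>tangent_space A p. N\<^sub>0 p (N\<^sub>0 p v) = (\<lambda>f. c * v f)"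
    then show "nijenhuis (big_sections A) (courant_bracket A) (big_morphism A N\<^sub>0)"
      using nijenhuis_if_square_scalar by blast
  qed
qed

end
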